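(* For rational $N>1/4$ let $\mathcal{E}_N$ be the elliptic curve over $\mathbb{Q}$ given by $v^2=u^3+2(2N^2+2N-1)u^2-(4N-1)u$, and let $T_6^+=(1-4N,\,2N(4N-1))\in\mathcal{E}_N(\mathbb{Q})$. (i) If $N=m^2+1$ for a rational number $m>1$, then the rank of $\mathcal{E}_N$ is positive, with a non-torsion point $$P=\left(\frac{1}{m^2},\ \frac{3m^2+1}{m^3}\right)$$ such that the point $$-P-T_6^+=\left(-\frac{(4m^2+3)(m+1)^2}{(2m^2-m+1)^2},\ \frac{2(m+1)(4m^2+3)(m^2+1)(2m^3+m^2+2m-1)}{(2m^2-m+1)^3}\right)$$ leads to the triangle with sides $$f=(m-1)(2m^2+m+1)^2,\quad g=(m+1)(2m^2-m+1)^2,\quad h=4m(m^2+1).$$ (ii) If $N=m^2-1>1/4$ for a rational number $m>1$, then the rank of $\mathcal{E}_N$ is positive, with a non-torsion point $$P=\left(\frac{1}{m^2},\ \frac{m^2-1}{m^3}\right)$$ such that the point $$-P-T_6^+=\left(-\frac{4m^2-5}{(2m-1)^2},\ \frac{2(m-1)(4m^2-5)(2m^2+m+1)}{(2m-1)^3}\right)$$ leads to the triangle with sides $$f=(m-1)(2m+1)^2,\quad g=(m+1)(2m-1)^2,\quad h=4m.$$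
   Context: The rank of $\mathcal{E}_N$ is the rank of the group $\mathcal{E}_N(\mathbb{Q})$, with the usual group law having the point at infinity as neutral element. A rational point $(u,v)$ on $\mathcal{E}_N$ "leads to" the triangle with sides $f,g,h$ if, setting $$x=-\frac{4N(v+2Nu)}{(u-1)(u+4N-1)},$$ $$A_1=-x^2-2(2N-1)x+4N,\qquad A_2=-x^2+2(2N+1)x-4N,$$ $$B=x^4+4(2N-1)x^3+4(4N^2-2N+1)x^2-32N^2x+16N^2,$$ one has, for some positive rational $s$ (i.e. up to scaling), $$f=\frac{s}{2x}(A_1-\sqrt{B}),\quad g=sx,\quad h=\frac{s}{2x}(A_2+\sqrt{B})$$ (with $\sqrt{B}$ the non-negative square root), and $f,g,h$ are the side lengths of a non-degenerate triangle with $R/r=N$, where $R$ is its circumradius and $r$ is the radius of the excircle touching the side $h$ from outside; explicitly $\frac{R}{r}=\frac{2fgh}{(f+g+h)(f-g-h)(g-h-f)}$. *)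

theory Defs
  imports
    "HOL-Analysis.Analysis"
    "HOL-Algebra.FiniteProduct"
    "HOL-Library.Extended_Nat"
begin

section \<open>Rank of an abelian group\<close>

definition int_independent :: "('a, 'b) monoid_scheme \<Rightarrow> 'a set \<Rightarrow> bool" where
  "int_independent G S \<longleftrightarrow> finite S \<and> S \<subseteq> carrier G \<and>
     (\<forall>c :: 'a \<Rightarrow> int. finprod G (\<lambda>x. x [^]\<^bsub>G\<^esub> c x) S = \<one>\<^bsub>G\<^esub> \<longrightarrow> (\<forall>x\<in>S. c x = 0))"

text \<open>
  The largest number of \<open>\<int>\<close>-independent elements; for a finitely generated abelian group
  this is the \<open>r\<close> for which the group modulo torsion is isomorphic to \<open>\<int>\<close> to the power \<open>r\<close>.
\<close>

definition abelian_rank :: "('a, 'b) monoid_scheme \<Rightarrow> enat" where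
  "abelian_rank G = (SUP S \<in> {S. int_independent G S}. enat (card S))"

definition non_torsion :: "('a, 'b) monoid_scheme \<Rightarrow> 'a \<Rightarrow> bool" where
  "non_torsion G x \<longleftrightarrow> x \<in> carrier G \<and> (\<forall>n::nat. n > 0 \<longrightarrow> x [^]\<^bsub>G\<^esub> n \<noteq> \<one>\<^bsub>G\<^esub>)"


section \<open>The curves\<close>

datatype ec_point = Infinity | Affine rat rat

text \<open>Chord-and-tangent addition on \<open>v\<^sup>2 = u\<^sup>3 + a u\<^sup>2 + b u\<close>.\<close>

fun ec_add :: "rat \<Rightarrow> rat \<Rightarrow> ec_point \<Rightarrow> ec_point \<Rightarrow> ec_point" where
  "ec_add a b Infinity Q = Q"
| "ec_add a b P Infinity = P"
| "ec_add a b (Affine u1 v1) (Affine u2 v2) =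
     (if u1 = u2 \<and> v1 = - v2 then Infinity
      else let l = (if u1 = u2 then (3 * u1^2 + 2 * a * u1 + b) / (2 * v1)
                    else (v2 - v1) / (u2 - u1));
               u3 = l^2 - a - u1 - u2
           in Affine u3 (l * (u1 - u3) - v1))"

definition ec_group :: "rat \<Rightarrow> rat \<Rightarrow> ec_point monoid" where
  "ec_group a b =
     \<lparr> carrier = insert Infinity {Affine u v | u v. v^2 = u^3 + a * u^2 + b * u},
       mult = ec_add a b,
       one = Infinity \<rparr>"

definition E :: "rat \<Rightarrow> ec_point monoid" where
  "E N = ec_group (2 * (2 * N^2 + 2 * N - 1)) (- (4 * N - 1))"

definition T6 :: "rat \<Rightarrow> ec_point" where
  "T6 N = Affine (1 - 4 * N) (2 * N * (4 * N - 1))"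

text \<open>
  The discriminant of the cubic \<open>u\<^sup>3 + a u\<^sup>2 + b u\<close> is \<open>b\<^sup>2 (a\<^sup>2 - 4 b)\<close>, so
  \<open>E N\<close> is an elliptic curve.
\<close>

lemma E_nonsingular:
  fixes N :: rat
  assumes "N > 1/4"
  defines "a \<equiv> 2 * (2 * N^2 + 2 * N - 1)" and "b \<equiv> - (4 * N - 1)"
  shows "b^2 * (a^2 - 4 * b) \<noteq> 0"
proof -
  have "a^2 - 4 * b = 16 * N^3 * (N + 2)"
    unfolding a_def b_def by (simp add: algebra_simps power2_eq_square power3_eq_cube)
  moreover have "N > 0" using assms(1) by (rule less_trans[rotated]) simp
  moreover have "b \<noteq> 0" using assms(1) by (simp add: b_def)
  ultimately show ?thesis by simp
qed


section \<open>Triangles\<close>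

definition is_circumradius :: "real^2 \<Rightarrow> real^2 \<Rightarrow> real^2 \<Rightarrow> real \<Rightarrow> bool" where
  "is_circumradius A B C R \<longleftrightarrow> (\<exists>Z. dist Z A = R \<and> dist Z B = R \<and> dist Z C = R)"

definition touches_at :: "real^2 \<Rightarrow> real \<Rightarrow> real^2 \<Rightarrow> real^2 \<Rightarrow> real^2 \<Rightarrow> bool" where
  "touches_at J r X Y T \<longleftrightarrow> affine hull {X, Y} \<inter> sphere J r = {T}"

text \<open>
  Radius of the excircle on the side \<open>AB\<close>. Of the four circles tangent to all three side lines,
  only the incircle and this excircle have their point of contact with the line \<open>AB\<close> on the
  side itself, and the incircle has its centre in the triangle.
\<close>

definition is_exradius :: "real^2 \<Rightarrow> real^2 \<Rightarrow> real^2 \<Rightarrow> real \<Rightarrow> bool" where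
  "is_exradius A B C r \<longleftrightarrow> r > 0 \<and>
     (\<exists>J. J \<notin> convex hull {A, B, C} \<and>
          (\<exists>T \<in> closed_segment A B. touches_at J r A B T) \<and>
          (\<exists>T. touches_at J r B C T) \<and>
          (\<exists>T. touches_at J r C A T))"

text \<open>
  \<open>f\<close>, \<open>g\<close>, \<open>h\<close> are the sides of a non-degenerate triangle in which the circumradius is
  \<open>N\<close> times the radius of the excircle touching the side \<open>h\<close> from outside. In terms of the
  sides, this ratio is \<open>2 f g h / ((f + g + h) (f - g - h) (g - h - f))\<close>.
\<close>

definition triangle_with_ratio :: "real \<Rightarrow> real \<Rightarrow> real \<Rightarrow> real \<Rightarrow> bool" where
  "triangle_with_ratio N f g h \<longleftrightarrow>
     (\<exists>A B C :: real^2. \<exists>R r.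
        \<not> collinear {A, B, C} \<and>
        dist B C = f \<and> dist C A = g \<and> dist A B = h \<and>
        is_circumradius A B C R \<and> is_exradius A B C r \<and> R / r = N)"


section \<open>From points to triangles\<close>

text \<open>
  The conditions that the denominators do not vanish and that \<open>B\<close> is non-negative make the
  formulas meaningful; the library square root
  is total, with \<open>sqrt (- y) = - sqrt y\<close>.
\<close>

definition leads_to :: "rat \<Rightarrow> ec_point \<Rightarrow> real \<Rightarrow> real \<Rightarrow> real \<Rightarrow> bool" where
  "leads_to N P f g h \<longleftrightarrow>
     P \<in> carrier (E N) \<and>
     (\<exists>u v. P = Affine u v \<and> (u - 1) * (u + 4 * N - 1) \<noteq> 0 \<and>
       (let x = - (4 * N * (v + 2 * N * u) / ((u - 1) * (u + 4 * N - 1)));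
            A1 = - (x^2) - 2 * (2 * N - 1) * x + 4 * N;
            A2 = - (x^2) + 2 * (2 * N + 1) * x - 4 * N;
            B = x^4 + 4 * (2 * N - 1) * x^3 + 4 * (4 * N^2 - 2 * N + 1) * x^2
                  - 32 * N^2 * x + 16 * N^2
        in x \<noteq> 0 \<and> B \<ge> 0 \<and>
           (\<exists>s::rat. s > 0 \<and>
              f = of_rat s / (2 * of_rat x) * (of_rat A1 - sqrt (of_rat B)) \<and>
              g = of_rat s * of_rat x \<and>
              h = of_rat s / (2 * of_rat x) * (of_rat A2 + sqrt (of_rat B))) \<and>
           triangle_with_ratio (of_rat N) f g h))"

end

(*
  A point of infinite order is found by reduction. Since m > 1, some prime l divides the numerator
  of m, and P reduces to the point at infinity modulo l: its coordinates z = u / v and w = 1 / v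
  there are divisible by l. In these coordinates adding P is one rational formula, valid for chords
  and tangents alike, so the coordinate z_n of the n-th multiple of P satisfies
  z_(n+1) = z_n + z_1 (1 + h_n) with h_n divisible by l^2. The formula also shows, by induction on k,
  that the k-th differences of z_n, w_n and h_n are divisible by l^k; hence, by Newton's forward
  difference formula, h_0 + ... + h_(n-1) is divisible by n l, and z_n is n z_1 times a unit.
  This avoids the associativity of the group law and the formal logarithm.

  For the triangles, everything reduces to polynomial identities in m once a triangle with given
  sides is placed in coordinates, with its circumcentre and its excentre.
*)

theory Submission
  imports Defs "HOL-Computational_Algebra.Primes"
begin

section \<open>The triangle with given sides\<close>

text \<open>The obstacle is that \<open>n\<close> may be divisible by any power of \<open>l\<close>.
  In \<open>z_n = z_1 (n + h_0 + ... + h_(n-1))\<close>, divisibility of each \<open>h_i\<close> by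
  a fixed power of \<open>l\<close> cannot keep the sum from cancelling \<open>n\<close>; the error
  has to carry the factor \<open>n\<close> itself. Arbitrary multiples of \<open>l\<close> do not
  add up to multiples of \<open>n\<close>, but binomial coefficients nearly do: the sum of
  \<open>i choose j\<close> over \<open>i < n\<close> is \<open>n choose (j + 1)\<close>, that is
  \<open>n / (j + 1)\<close> times \<open>(n - 1) choose j\<close>, and the factor
  \<open>l^j\<close> of the \<open>j\<close>-th difference pays for \<open>j + 1\<close>. The
  differences are small because each step moves \<open>z\<close> and \<open>w\<close> by
  \<open>z_1\<close> times an \<open>l\<close>-integral rational function of \<open>z\<close> and
  \<open>w\<close>, and \<open>l\<close> divides \<open>z_1\<close>: each level of divisibility
  yields the next. The prime comes from the numerator of \<open>m\<close> because
  \<open>P = (1/m^2, k/m^3)\<close> has \<open>z = m/k\<close> and \<open>w = m^3/k\<close>, where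
  \<open>k\<close> is \<open>1\<close> or \<open>-1\<close> modulo \<open>l\<close>, and the
  coefficients of the curve are polynomials in \<open>m\<close>. Only sums with fixed second summand
  \<open>P\<close> occur, since powers are built by multiplying by \<open>P\<close> on the
  right.\<close>

lemma inner_real2: "(x :: real^2) \<bullet> y = x$1 * y$1 + x$2 * y$2"
  by (simp add: inner_vec_def sum_2)

lemma dist_real2: "dist (x :: real^2) y = sqrt ((x$1 - y$1)^2 + (x$2 - y$2)^2)"
  by (simp add: dist_norm norm_eq_sqrt_inner inner_real2 power2_eq_square)

text \<open>By Pythagoras every other point of the line is farther from \<open>J\<close> than the
  foot \<open>T\<close> of the perpendicular, so the circle meets the line in \<open>T\<close>
  alone.\<close>

lemma touches_atI:
  assumes "X \<noteq> Y" and T: "T = X + t *\<^sub>R (Y - X)"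
    and orth: "(J - T) \<bullet> (Y - X) = 0" and dist: "dist J T = r"
  shows "touches_at J r X Y T"
proof -
  have uniq: "Z = T" if Z: "Z = X + u *\<^sub>R (Y - X)" and "dist J Z = r" for Z u
  proof -
    have ZT: "J - Z = (J - T) + (t - u) *\<^sub>R (Y - X)"
      by (simp add: Z T algebra_simps)
    have "r^2 = (J - Z) \<bullet> (J - Z)"
      using \<open>dist J Z = r\<close> by (simp add: dist_norm flip: power2_norm_eq_inner)
    also have "\<dots> = (J - T) \<bullet> (J - T) + (t - u)^2 * ((Y - X) \<bullet> (Y - X))"
      unfolding ZT using orth
      by (simp add: inner_add_left inner_add_right inner_commute power2_eq_square)
    also have "(J - T) \<bullet> (J - T) = r^2"
      using dist by (simp add: dist_norm flip: power2_norm_eq_inner)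
    finally have "t = u" using \<open>X \<noteq> Y\<close> by simp
    then show "Z = T" by (simp add: Z T)
  qed
  have "T \<in> affine hull {X, Y}"
    unfolding affine_hull_2_alt T by blast
  moreover have "T \<in> sphere J r" using dist by simp
  moreover have "Z = T" if "Z \<in> affine hull {X, Y}" "Z \<in> sphere J r" for Z
    using that uniq unfolding affine_hull_2_alt by auto
  ultimately show ?thesis unfolding touches_at_def by blast
qed

text \<open>The foot of the perpendicular lies at signed distance \<open>s\<close> from
  \<open>C\<close>, and Pythagoras then leaves \<open>r\<close> for its distance from
  \<open>J\<close>. In the application \<open>s\<close> is the semiperimeter, the length of the
  tangents from \<open>C\<close> to the excircle beyond \<open>AB\<close>.\<close>

lemma touches_at_side:
  assumes "X \<noteq> C" and "(J - C) \<bullet> (X - C) = s * dist X C"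
    and "(J - C) \<bullet> (J - C) = s^2 + r^2" and "r \<ge> 0"
  shows "\<exists>T. touches_at J r C X T"
proof -
  define d where "d = dist X C"
  have "d > 0" using assms(1) by (simp add: d_def)
  have dd: "(X - C) \<bullet> (X - C) = d^2"
    by (simp add: d_def dist_norm power2_norm_eq_inner)
  define T where "T = C + (s / d) *\<^sub>R (X - C)"
  have JT: "J - T = (J - C) - (s / d) *\<^sub>R (X - C)" by (simp add: T_def)
  have "(J - T) \<bullet> (X - C) = 0"
    unfolding JT using assms(2) dd \<open>d > 0\<close>
    by (simp add: inner_diff_left d_def[symmetric] power2_eq_square)
  moreover have "(J - T) \<bullet> (J - T) = r^2"
  proof -
    have "(J - T) \<bullet> (J - T) = (J - C) \<bullet> (J - C) - 2 * (s / d) * ((J - C) \<bullet> (X - C))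
        + (s / d)^2 * ((X - C) \<bullet> (X - C))"
      unfolding JT by (simp add: inner_diff_left inner_diff_right inner_commute power2_eq_square)
    also have "\<dots> = r^2"
      using assms(2,3) dd \<open>d > 0\<close>
      by (simp add: d_def[symmetric] power2_eq_square field_simps)
    finally show ?thesis .
  qed
  then have "dist J T = r"
    using \<open>r \<ge> 0\<close> by (simp add: dist_norm norm_eq_sqrt_inner)
  ultimately show ?thesis
    using touches_atI[of C X T "s / d" J r] assms(1) T_def by metis
qed

lemma touches_at_commute: "touches_at J r X Y T \<longleftrightarrow> touches_at J r Y X T"
  by (simp add: touches_at_def insert_commute)

text \<open>The triangle is placed with \<open>AB\<close> on the first axis and
  \<open>C = (p, q)\<close> above it. With area \<open>K = h q / 2\<close> and semiperimeter
  \<open>s\<close>, the classical formulas \<open>R = f g h / (4 K)\<close> and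
  \<open>r = K / (s - h)\<close> supply the two radii.\<close>

lemma triangle_with_ratioI:
  fixes f g h N :: real
  assumes pos: "f > 0" "g > 0" "h > 0"
    and tri: "f < g + h" "g < h + f" "h < f + g"
    and ratio: "2 * f * g * h = N * ((f + g + h) * (f - g - h) * (g - h - f))"
  shows "triangle_with_ratio N f g h"
proof -
  \<comment> \<open>The law of cosines gives the foot \<open>p\<close> of the altitude from
    \<open>C\<close>; its length is \<open>q\<close>, and \<open>heron\<close> shows that the root
    is taken of a positive number.\<close>
  define p where "p = (g^2 + h^2 - f^2) / (2 * h)"
  define q where "q = sqrt (g^2 - p^2)"
  have ph: "2 * h * p = g^2 + h^2 - f^2" using pos by (simp add: p_def)
  have ff: "f^2 = g^2 + h^2 - 2 * h * p" using ph by simp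
  have heron: "4 * h^2 * (g^2 - p^2) = (f + g + h) * (g + h - f) * (h + f - g) * (f + g - h)"
  proof -
    have "4 * h^2 * (g^2 - p^2) = (2 * h * g)^2 - (2 * h * p)^2"
      by (simp add: algebra_simps power2_eq_square)
    also have "\<dots> = (2 * h * g)^2 - (g^2 + h^2 - f^2)^2" by (simp only: ph)
    also have "\<dots> = (f + g + h) * (g + h - f) * (h + f - g) * (f + g - h)" by algebra
    finally show ?thesis .
  qed
  have "4 * h^2 * (g^2 - p^2) > 0"
    unfolding heron using pos tri by (intro mult_pos_pos) auto
  then have qq: "q^2 = g^2 - p^2" and "q > 0"
    using pos by (simp_all add: q_def zero_less_mult_iff)
  define k where "k = f + g - h"
  have "k > 0" using tri by (simp add: k_def)
  define r where "r = q * h / k"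
  have "r > 0" using \<open>q > 0\<close> \<open>k > 0\<close> pos by (simp add: r_def)
  have rk: "r * k = q * h" using \<open>k > 0\<close> by (simp add: r_def)
  have qk: "4 * h^2 * q^2 = (f + g + h) * (g + h - f) * (h + f - g) * k"
    using heron by (simp add: qq k_def)
  define s where "s = (f + g + h) / 2"
  \<comment> \<open>The excircle touches \<open>AB\<close> at distance \<open>s - g\<close> from
    \<open>A\<close>, which is therefore the abscissa of \<open>J\<close>; the excentre lies below
    the axis, opposite to \<open>C\<close>.\<close>
  define A B C J Z :: "real^2" where "A = vector [0, 0]" and "B = vector [h, 0]"
    and "C = vector [p, q]" and "J = vector [s - g, - r]"
    and "Z = vector [h / 2, (g^2 - h * p) / (2 * q)]"
  note coords = A_def B_def C_def J_def Z_def vector_2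
  have BC: "dist B C = f"
  proof -
    have "(h - p)^2 + q^2 = f^2" using qq ph by algebra
    then show ?thesis using pos by (simp add: dist_real2 coords)
  qed
  have CA: "dist C A = g" using qq pos by (simp add: dist_real2 coords)
  have AB: "dist A B = h" using pos by (simp add: dist_real2 coords)
  have ncol: "\<not> collinear {A, B, C}"
  proof
    assume "collinear {A, B, C}"
    then have "collinear {0, A - B, C - B}" using collinear_3[of A B C] by (metis NO_MATCH_def)
    then consider "A - B = 0" | "C - B = 0" | c where "C - B = c *\<^sub>R (A - B)"
      by (auto simp: collinear_lemma)
    then show False
    proof cases
      case 1
      then have "(A - B)$1 = 0" by simp
      then show ?thesis using pos by (simp add: coords)
    next
      case 2
      then have "(C - B)$2 = 0" by simp
      then show ?thesis using \<open>q > 0\<close> by (simp add: coords)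
    next
      case 3
      then have "(C - B)$2 = (c *\<^sub>R (A - B))$2" by simp
      then show ?thesis using \<open>q > 0\<close> by (simp add: coords)
    qed
  qed
  have circ: "is_circumradius A B C (f * g / (2 * q))"
  proof -
    define y where "y = (g^2 - h * p) / (2 * q)"
    have y: "2 * q * y = g^2 - h * p" using \<open>q > 0\<close> by (simp add: y_def)
    have "(2 * q)^2 * ((h / 2)^2 + y^2) = (f * g)^2"
    proof -
      have "(2 * q)^2 * ((h / 2)^2 + y^2) = q^2 * h^2 + (2 * q * y)^2"
        by (simp add: algebra_simps power2_eq_square)
      also have "\<dots> = (f * g)^2"
        unfolding y power_mult_distrib qq ff by algebra
      finally show ?thesis .
    qed
    then have R: "(h / 2)^2 + y^2 = (f * g / (2 * q))^2"
      using \<open>q > 0\<close> by (simp add: field_simps)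
    have R': "(h / 2 - p)^2 + (y - q)^2 = (h / 2)^2 + y^2"
      using y qq by (simp add: power2_eq_square algebra_simps)
    have eq: "sqrt ((h / 2)^2 + y^2) = f * g / (2 * q)"
      unfolding R using pos \<open>q > 0\<close> by simp
    have "dist Z A = f * g / (2 * q)" "dist Z C = f * g / (2 * q)"
      using eq R' by (simp_all add: dist_real2 coords flip: y_def)
    moreover have "dist Z B = f * g / (2 * q)"
    proof -
      have "(h / 2 - h)^2 = (h / 2)^2" by (simp add: power2_eq_square)
      with eq show ?thesis by (simp add: dist_real2 coords flip: y_def)
    qed
    ultimately show ?thesis unfolding is_circumradius_def by blast
  qed
  have "k \<noteq> 0" using \<open>k > 0\<close> by simp
  have JCB: "(J - C) \<bullet> (B - C) = s * f"
  proof -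
    \<comment> \<open>Multiplying by \<open>2 k\<close> allows \<open>r k = q h\<close> to eliminate
      \<open>r\<close>; what remains is polynomial in the sides and \<open>p\<close>.\<close>
    have "2 * k * ((s - g - p) * (h - p) + (r + q) * q - s * f) = 2 * k * ((s - g - p) * (h - p) + q^2 - s * f) + 2 * q * (r * k)"
      by (simp add: algebra_simps power2_eq_square)
    also have "\<dots> = 2 * k * ((s - g - p) * (h - p) + q^2 - s * f) + 2 * h * q^2"
      by (simp add: rk power2_eq_square)
    also have "\<dots> = 0"
      unfolding qq k_def s_def using ff by algebra
    finally have "(s - g - p) * (h - p) + (r + q) * q - s * f = 0"
      using \<open>k > 0\<close> by simp
    then show ?thesis
      by (simp add: inner_real2 coords algebra_simps power2_eq_square)
  qed
  have JCA: "(J - C) \<bullet> (A - C) = s * g"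
  proof -
    have "2 * k * ((s - g - p) * (- p) + (r + q) * q - s * g) = 2 * k * ((s - g - p) * (- p) + q^2 - s * g) + 2 * q * (r * k)"
      by (simp add: algebra_simps power2_eq_square)
    also have "\<dots> = 2 * k * ((s - g - p) * (- p) + q^2 - s * g) + 2 * h * q^2"
      by (simp add: rk power2_eq_square)
    also have "\<dots> = 0"
      unfolding qq k_def s_def using ff by algebra
    finally have "(s - g - p) * (- p) + (r + q) * q - s * g = 0"
      using \<open>k > 0\<close> by simp
    then show ?thesis
      by (simp add: inner_real2 coords algebra_simps power2_eq_square)
  qed
  have kgs: "k * (g - s) = h * (p - g)"
    using ff by (simp add: k_def s_def field_simps power2_eq_square)
  have JC: "(J - C) \<bullet> (J - C) = s^2 + r^2"
  proof -
    have "2 * k * ((s - g - p)^2 + (r + q)^2 - (s^2 + r^2)) = 2 * k * ((s - g - p)^2 + q^2 - s^2) + 4 * q * (r * k)"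
      by (simp add: algebra_simps power2_eq_square)
    also have "\<dots> = 2 * k * ((s - g - p)^2 + q^2 - s^2) + 4 * h * q^2"
      by (simp add: rk power2_eq_square)
    also have "\<dots> = 4 * (g + p) * (k * (g - s)) + 4 * h * ((g + p) * (g - p))"
      unfolding qq by (simp add: algebra_simps power2_eq_square)
    also have "\<dots> = 0" unfolding kgs by (simp add: algebra_simps)
    finally have "(s - g - p)^2 + (r + q)^2 - (s^2 + r^2) = 0"
      using \<open>k > 0\<close> by simp
    then show ?thesis
      by (simp add: inner_real2 coords algebra_simps power2_eq_square)
  qed
  have "J \<notin> convex hull {A, B, C}"
  proof -
    have "convex {x :: real^2. x$2 \<ge> 0}" by (simp add: convex_def)
    then have "convex hull {A, B, C} \<subseteq> {x. x$2 \<ge> 0}"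
      using \<open>q > 0\<close> by (intro hull_minimal) (auto simp: coords)
    then show ?thesis using \<open>r > 0\<close> by (auto simp: coords)
  qed
  moreover have "\<exists>T \<in> closed_segment A B. touches_at J r A B T"
  proof -
    have "A \<noteq> B" using AB pos by auto
    define t where "t = (s - g) / h"
    have "0 \<le> t" "t \<le> 1" using pos tri by (simp_all add: t_def s_def field_simps)
    let ?T = "A + t *\<^sub>R (B - A)"
    have "t * h = s - g" using pos by (simp add: t_def)
    then have "touches_at J r A B ?T"
      using \<open>r > 0\<close> \<open>A \<noteq> B\<close>
      by (intro touches_atI[where t = t]) (simp_all add: inner_real2 dist_real2 coords)
    moreover have "?T \<in> closed_segment A B"
      using \<open>0 \<le> t\<close> \<open>t \<le> 1\<close> unfolding in_segment by (auto simp: algebra_simps intro!: exI[of _ t])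
    ultimately show ?thesis by blast
  qed
  moreover have "\<exists>T. touches_at J r B C T"
  proof -
    have "\<exists>T. touches_at J r C B T"
      using JCB JC BC pos \<open>r > 0\<close> by (intro touches_at_side[of _ _ _ s]) auto
    then show ?thesis by (simp add: touches_at_commute)
  qed
  moreover have "\<exists>T. touches_at J r C A T"
    using JCA JC CA pos \<open>r > 0\<close>
    by (intro touches_at_side[of _ _ _ s]) (auto simp: dist_commute)
  ultimately have "is_exradius A B C r"
    unfolding is_exradius_def using \<open>r > 0\<close> by blast
  moreover have "f * g / (2 * q) / r = N"
  proof -
    have "2 * h * (f * g * k) = N * ((f + g + h) * (f - g - h) * (g - h - f)) * k"
      unfolding ratio[symmetric] by (simp add: mult_ac)
    also have "\<dots> = N * ((f + g + h) * (g + h - f) * (h + f - g) * k)"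
      by (simp add: algebra_simps)
    also have "\<dots> = 2 * h * (N * (2 * q * (q * h)))"
      by (simp add: power2_eq_square flip: qk)
    finally have "f * g * k = N * (2 * q * (q * h))" using pos by (simp add: mult_ac)
    then have "f * g * k = N * (2 * q * (r * k))" by (simp only: rk)
    then have "f * g = N * (2 * q * r)" using \<open>k \<noteq> 0\<close> by simp
    then show ?thesis using \<open>q > 0\<close> \<open>r > 0\<close> by simp
  qed
  ultimately show ?thesis
    unfolding triangle_with_ratio_def using ncol BC CA AB circ by blast
qed

section \<open>Rational numbers integral at a prime\<close>

text \<open>The localization of the integers at \<open>l\<close>. Fractions need not be in lowest
  terms, so closure under the ring operations only needs that a prime \<open>l\<close> does not
  divide a product of denominators; \<open>b = 0\<close> is excluded because \<open>l\<close>
  divides \<open>0\<close>.\<close>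

definition integral_at :: "int \<Rightarrow> rat set" where
  "integral_at l = {of_int a / of_int b | a b. \<not> l dvd b}"

lemma integral_atI: "x = of_int a / of_int b \<Longrightarrow> \<not> l dvd b \<Longrightarrow> x \<in> integral_at l"
  unfolding integral_at_def by blast

lemma integral_at_of_int [simp, intro]:
  assumes "prime l" shows "of_int a \<in> integral_at l"
  using assms by (intro integral_atI[of _ a 1]) (auto dest: not_prime_unit)

lemma
  assumes "prime l"
  shows integral_at_0: "0 \<in> integral_at l" and integral_at_1: "1 \<in> integral_at l"
    and integral_at_numeral: "numeral k \<in> integral_at l"
    and integral_at_of_nat: "of_nat n \<in> integral_at l"
  using integral_at_of_int[OF assms, of 0] integral_at_of_int[OF assms, of 1]
    integral_at_of_int[OF assms, of "numeral k"] integral_at_of_int[OF assms, of "int n"]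
  by simp_all

lemma integral_at_mult:
  assumes "prime l" "x \<in> integral_at l" "y \<in> integral_at l"
  shows "x * y \<in> integral_at l"
proof -
  obtain a b where x: "x = of_int a / of_int b" "\<not> l dvd b"
    using assms(2) unfolding integral_at_def by blast
  obtain c d where y: "y = of_int c / of_int d" "\<not> l dvd d"
    using assms(3) unfolding integral_at_def by blast
  show ?thesis
    using x y assms(1) by (intro integral_atI[of _ "a * c" "b * d"]) (auto simp: prime_dvd_mult_iff)
qed

lemma integral_at_add:
  assumes "prime l" "x \<in> integral_at l" "y \<in> integral_at l"
  shows "x + y \<in> integral_at l"
proof -
  obtain a b where x: "x = of_int a / of_int b" "\<not> l dvd b"
    using assms(2) unfolding integral_at_def by blast
  obtain c d where y: "y = of_int c / of_int d" "\<not> l dvd d"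
    using assms(3) unfolding integral_at_def by blast
  have "b \<noteq> 0" "d \<noteq> 0" using x y by auto
  then have "x + y = of_int (a * d + c * b) / of_int (b * d)"
    by (simp add: x y field_simps)
  then show ?thesis
    using x y assms(1)
    by (intro integral_atI[of _ "a * d + c * b" "b * d"]) (auto simp: prime_dvd_mult_iff)
qed

lemma integral_at_uminus: "prime l \<Longrightarrow> x \<in> integral_at l \<Longrightarrow> - x \<in> integral_at l"
  using integral_at_mult[OF _ integral_at_of_int[of l "- 1"], of x] by simp

lemma integral_at_diff:
  "prime l \<Longrightarrow> x \<in> integral_at l \<Longrightarrow> y \<in> integral_at l \<Longrightarrow> x - y \<in> integral_at l"
  using integral_at_add[of l x "- y"] integral_at_uminus[of l y] by simp

lemma integral_at_power: "prime l \<Longrightarrow> x \<in> integral_at l \<Longrightarrow> x ^ n \<in> integral_at l"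
  by (induction n) (auto intro: integral_at_1 integral_at_mult)

lemma integral_at_sum:
  "prime l \<Longrightarrow> (\<And>i. i \<in> A \<Longrightarrow> f i \<in> integral_at l) \<Longrightarrow> sum f A \<in> integral_at l"
  by (induction A rule: infinite_finite_induct) (auto intro: integral_at_0 integral_at_add)

lemmas integral_at_intros =
  integral_at_0 integral_at_1 integral_at_numeral integral_at_of_nat integral_at_of_int
  integral_at_mult integral_at_add integral_at_uminus integral_at_diff integral_at_power

text \<open>Numerator and denominator of \<open>1 + l x\<close> agree modulo \<open>l\<close>. All
  denominators in the addition formula will have this form.\<close>

lemma integral_at_unit:
  assumes "prime l" "x \<in> integral_at l"
  shows "1 + of_int l * x \<noteq> 0" and "1 / (1 + of_int l * x) \<in> integral_at l"
proof -
  obtain a b where x: "x = of_int a / of_int b" "\<not> l dvd b"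
    using assms(2) unfolding integral_at_def by blast
  have "b \<noteq> 0" using x by auto
  have ndvd: "\<not> l dvd b + l * a" using x by (simp add: dvd_add_left_iff)
  then have "b + l * a \<noteq> 0" by auto
  then have "(of_int (b + l * a) :: rat) \<noteq> 0" by (metis of_int_eq_0_iff)
  moreover have eq: "1 + of_int l * x = of_int (b + l * a) / of_int b"
    using \<open>b \<noteq> 0\<close> by (simp add: x field_simps)
  ultimately show "1 + of_int l * x \<noteq> 0" using \<open>b \<noteq> 0\<close> by simp
  show "1 / (1 + of_int l * x) \<in> integral_at l"
    using ndvd by (intro integral_atI[of _ b "b + l * a"]) (simp_all add: eq)
qed

text \<open>The witness \<open>e\<close> is the multiplicity of \<open>l\<close> in
  \<open>j + 1\<close>; the crude bound \<open>l ^ e \<le> j + 1\<close> is all that is used about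
  its size.\<close>

lemma prime_power_div_Suc_eventually:
  assumes "prime (l :: int)"
  shows "\<exists>e. of_int (l ^ e) \<le> (of_nat (Suc j) :: rat) \<and>
    (\<forall>i\<ge>e. of_int l ^ i / of_nat (Suc j) \<in> integral_at l)"
proof -
  have "Suc j \<noteq> 0" by simp
  have "\<not> is_unit l" using assms not_prime_unit by blast
  then obtain q where q: "int (Suc j) = l ^ multiplicity l (int (Suc j)) * q" "\<not> l dvd q"
    by (metis multiplicity_decompose' of_nat_eq_0_iff old.nat.distinct(2))
  define e where "e = multiplicity l (int (Suc j))"
  have "l > 0" using assms prime_gt_0_int by blast
  have "q > 0" using q(1) \<open>l > 0\<close> by (smt (verit) of_nat_0_less_iff zero_less_Suc zero_less_mult_pos zero_less_power)
  have "l ^ e * 1 \<le> l ^ e * q" using \<open>q > 0\<close> \<open>l > 0\<close> by (intro mult_left_mono) auto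
  then have le: "l ^ e \<le> int (Suc j)" using q(1) by (simp add: e_def)
  have Suc_eq: "(of_nat (Suc j) :: rat) = of_int l ^ e * of_int q"
    using arg_cong[OF q(1), of "of_int :: int \<Rightarrow> rat"] by (simp add: e_def)
  show ?thesis
  proof (intro exI conjI allI impI)
    have "(of_int (l ^ e) :: rat) \<le> of_int (int (Suc j))" using le by (simp only: of_int_le_iff)
    then show "(of_int (l ^ e) :: rat) \<le> of_nat (Suc j)" by simp
    fix i assume "i \<ge> e"
    then have "of_int l ^ i = (of_int l ^ e * of_int (l ^ (i - e)) :: rat)"
      by (simp flip: power_add)
    then have "of_int l ^ i / of_nat (Suc j) = (of_int (l ^ (i - e)) / of_int q :: rat)"
      unfolding Suc_eq using \<open>l > 0\<close> by simp
    then show "of_int l ^ i / (of_nat (Suc j) :: rat) \<in> integral_at l"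
      using q(2) by (rule integral_atI)
  qed
qed

text \<open>From \<open>2 ^ e \<le> l ^ e \<le> j + 1\<close> follows \<open>e \<le> j\<close>, and
  even \<open>e \<le> j - 1\<close> as soon as \<open>j + 1 < 2 ^ j\<close>, that is for
  \<open>j \<ge> 2\<close>.\<close>

lemma prime_power_div_Suc:
  assumes "prime (l :: int)"
  shows "of_int l ^ j / of_nat (Suc j) \<in> integral_at l"
    and "j \<ge> 2 \<Longrightarrow> of_int l ^ (j - 1) / of_nat (Suc j) \<in> integral_at l"
proof -
  obtain e where e: "of_int (l ^ e) \<le> (of_nat (Suc j) :: rat)"
    and int: "\<And>i. i \<ge> e \<Longrightarrow> of_int l ^ i / of_nat (Suc j) \<in> integral_at l"
    using prime_power_div_Suc_eventually[OF assms] by blast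
  have "2 \<le> l" using assms prime_ge_2_int by blast
  have "(of_int (l ^ e) :: rat) \<le> of_int (int (Suc j))" using e by simp
  then have le: "l ^ e \<le> int (Suc j)" by (simp only: of_int_le_iff)
  have "(2::int) ^ e \<le> l ^ e" using \<open>2 \<le> l\<close> by (intro power_mono) auto
  then have "int (2 ^ e) \<le> int (Suc j)" using le by simp
  then have 2: "2 ^ e \<le> Suc j" by (simp only: of_nat_le_iff)
  have "e < (2::nat) ^ e" by (rule less_exp)
  then show "of_int l ^ j / of_nat (Suc j) \<in> integral_at l" using 2 by (intro int) linarith
  assume "j \<ge> 2"
  have "Suc k < 2 ^ k" if "k \<ge> 2" for k :: nat
    using that by (induction k rule: dec_induct) auto
  have "e \<le> j - 1"
  proof (rule ccontr)
    assume "\<not> e \<le> j - 1"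
    then have "j \<le> e" using \<open>j \<ge> 2\<close> by simp
    then have "(2::nat) ^ j \<le> 2 ^ e" by (intro power_increasing) auto
    then show False using 2 \<open>\<And>k. 2 \<le> k \<Longrightarrow> Suc k < 2 ^ k\<close>[of j] \<open>j \<ge> 2\<close> by linarith
  qed
  then show "of_int l ^ (j - 1) / of_nat (Suc j) \<in> integral_at l" by (rule int)
qed

section \<open>Sequences with small iterated differences\<close>

text \<open>Unfolded, the \<open>j\<close>-th difference lies in \<open>l ^ j\<close> times the
  local ring for every \<open>j \<le> k\<close>. The existential \<open>g\<close> replaces a
  division by \<open>l\<close>, and the recursion lets products and reciprocals be treated by
  induction through their difference rules.\<close>

fun small_diffs :: "int \<Rightarrow> nat \<Rightarrow> (nat \<Rightarrow> rat) \<Rightarrow> bool" where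
  "small_diffs l 0 f \<longleftrightarrow> (\<forall>n. f n \<in> integral_at l)"
| "small_diffs l (Suc k) f \<longleftrightarrow> (\<forall>n. f n \<in> integral_at l) \<and>
     (\<exists>g. small_diffs l k g \<and> (\<forall>n. f (Suc n) = f n + of_int l * g n))"

lemma small_diffs_integral: "small_diffs l k f \<Longrightarrow> f n \<in> integral_at l"
  by (cases k) auto

lemma small_diffs_Suc: "small_diffs l (Suc k) f \<Longrightarrow> small_diffs l k f"
proof (induction k arbitrary: f)
  case (Suc k)
  then obtain g where "small_diffs l (Suc k) g" "\<forall>n. f (Suc n) = f n + of_int l * g n"
    unfolding small_diffs.simps(2)[of l "Suc k"] by blast
  moreover have "f n \<in> integral_at l" for n using Suc.prems by (rule small_diffs_integral)
  ultimately show ?case using Suc.IH unfolding small_diffs.simps(2)[of l k f] by blast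
qed simp

lemma small_diffs_const: "prime l \<Longrightarrow> c \<in> integral_at l \<Longrightarrow> small_diffs l k (\<lambda>_. c)"
proof (induction k arbitrary: c)
  case (Suc k)
  have "small_diffs l k (\<lambda>_. 0)" using Suc.IH[of 0] Suc.prems integral_at_0 by blast
  then show ?case using Suc.prems by (auto intro!: exI[of _ "\<lambda>_. 0"])
qed auto

lemma small_diffs_add:
  assumes "prime l"
  shows "small_diffs l k f \<Longrightarrow> small_diffs l k g \<Longrightarrow> small_diffs l k (\<lambda>n. f n + g n)"
proof (induction k arbitrary: f g)
  case 0
  then show ?case using assms by (auto intro: integral_at_add)
next
  case (Suc k)
  from Suc.prems obtain f' g' where
    "small_diffs l k f'" "\<forall>n. f (Suc n) = f n + of_int l * f' n"
    "small_diffs l k g'" "\<forall>n. g (Suc n) = g n + of_int l * g' n" by auto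
  then show ?case using Suc.prems Suc.IH[of f' g'] assms
    by (auto intro!: exI[of _ "\<lambda>n. f' n + g' n"] integral_at_add simp: algebra_simps)
qed

text \<open>Discrete Leibniz rule: the increment of \<open>f g\<close> is
  \<open>l (f g' + f' g + l f' g')\<close>, where \<open>f\<close> and \<open>g\<close> themselves
  enter at the lower level \<open>k\<close>.\<close>

lemma small_diffs_mult:
  assumes "prime l"
  shows "small_diffs l k f \<Longrightarrow> small_diffs l k g \<Longrightarrow> small_diffs l k (\<lambda>n. f n * g n)"
proof (induction k arbitrary: f g)
  case 0
  then show ?case using assms by (auto intro: integral_at_mult)
next
  case (Suc k)
  from Suc.prems obtain f' g' where
    f': "small_diffs l k f'" "\<forall>n. f (Suc n) = f n + of_int l * f' n" and
    g': "small_diffs l k g'" "\<forall>n. g (Suc n) = g n + of_int l * g' n" by auto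
  have "small_diffs l k f" "small_diffs l k g" using Suc.prems small_diffs_Suc by blast+
  moreover have "small_diffs l k (\<lambda>_. of_int l)" using assms by (intro small_diffs_const) auto
  ultimately have "small_diffs l k (\<lambda>n. f n * g' n + f' n * g n + of_int l * (f' n * g' n))"
    using f' g' Suc.IH assms by (intro small_diffs_add) auto
  then show ?case using Suc.prems f' g' assms
    by (auto intro!: exI[of _ "\<lambda>n. f n * g' n + f' n * g n + of_int l * (f' n * g' n)"]
        integral_at_mult simp: algebra_simps)
qed

lemma small_diffs_uminus: "prime l \<Longrightarrow> small_diffs l k f \<Longrightarrow> small_diffs l k (\<lambda>n. - f n)"
  using small_diffs_mult[of l k "\<lambda>_. - 1" f] small_diffs_const[of l "- 1" k]
    integral_at_of_int[of l "- 1"] by simp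

lemma small_diffs_diff:
  "prime l \<Longrightarrow> small_diffs l k f \<Longrightarrow> small_diffs l k g \<Longrightarrow> small_diffs l k (\<lambda>n. f n - g n)"
  using small_diffs_add[of l k f "\<lambda>n. - g n"] small_diffs_uminus[of l k g] by simp

lemma small_diffs_shift: "prime l \<Longrightarrow> small_diffs l k f \<Longrightarrow> small_diffs l k (\<lambda>n. f (Suc n))"
proof (induction k arbitrary: f)
  case (Suc k)
  then obtain g where g: "small_diffs l k g" "\<forall>n. f (Suc n) = f n + of_int l * g n" by auto
  have "small_diffs l k (\<lambda>n. g (Suc n))" using Suc g by blast
  moreover have "f (Suc n) \<in> integral_at l" for n
    using Suc.prems(2) by (rule small_diffs_integral)
  ultimately show ?case using g(2) unfolding small_diffs.simps(2) by blast
qed auto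

text \<open>The increment of \<open>1 / u\<close> is \<open>- l v n / (u n u (n + 1))\<close>, so
  the shifted sequence has to be small as well.\<close>

lemma small_diffs_inverse:
  assumes "prime l"
  shows "small_diffs l k u \<Longrightarrow> (\<And>n. u n \<noteq> 0) \<Longrightarrow> (\<And>n. 1 / u n \<in> integral_at l) \<Longrightarrow>
    small_diffs l k (\<lambda>n. 1 / u n)"
proof (induction k arbitrary: u)
  case (Suc k)
  then obtain v where v: "small_diffs l k v" and uv: "\<And>n. u (Suc n) = u n + of_int l * v n"
    by auto
  have "small_diffs l k u" using Suc.prems(1) by (rule small_diffs_Suc)
  then have "small_diffs l k (\<lambda>n. 1 / u n)" "small_diffs l k (\<lambda>n. 1 / u (Suc n))"
    using Suc.IH[of u] Suc.IH[of "\<lambda>n. u (Suc n)"] Suc.prems(2,3) small_diffs_shift[OF assms]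
    by auto
  then have "small_diffs l k (\<lambda>n. - (v n * ((1 / u n) * (1 / u (Suc n)))))"
    using v assms by (intro small_diffs_uminus small_diffs_mult)
  moreover have "1 / u (Suc n) = 1 / u n + of_int l * - (v n * ((1 / u n) * (1 / u (Suc n))))" for n
  proof -
    have "of_int l * v n = u (Suc n) - u n" using uv by simp
    then have "of_int l * - (v n * ((1 / u n) * (1 / u (Suc n))))
        = - ((u (Suc n) - u n) * ((1 / u n) * (1 / u (Suc n))))"
      by (metis mult.assoc mult_minus_right)
    also have "\<dots> = 1 / u (Suc n) - 1 / u n"
      using Suc.prems(2)[of n] Suc.prems(2)[of "Suc n"] by (simp add: field_simps)
    finally show ?thesis by simp
  qed
  ultimately show ?case using Suc.prems(3) unfolding small_diffs.simps(2) by blast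
qed auto

lemmas small_diffs_intros = small_diffs_const small_diffs_add small_diffs_mult
  small_diffs_uminus small_diffs_diff

lemma small_diffs_power:
  "prime l \<Longrightarrow> small_diffs l k f \<Longrightarrow> small_diffs l k (\<lambda>n. f n ^ i)"
  by (induction i) (auto intro: small_diffs_intros integral_at_1)

text \<open>Newton's forward difference formula, with \<open>l ^ j c j\<close> as the
  \<open>j\<close>-th difference at \<open>0\<close>. Only \<open>K\<close> differences are
  controlled, so the truncated sum is exact just for \<open>n \<le> K\<close>, and \<open>c\<close>
  may depend on \<open>K\<close>.\<close>

lemma small_diffs_newton:
  assumes "prime l"
  shows "small_diffs l K f \<Longrightarrow> \<exists>c. (\<forall>j. c j \<in> integral_at l) \<and>
    (\<forall>n\<le>K. f n = (\<Sum>j\<le>K. of_nat (n choose j) * of_int l ^ j * c j))"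
proof (induction K arbitrary: f)
  case 0
  then show ?case by (auto intro!: exI[of _ "\<lambda>_. f 0"])
next
  case (Suc K)
  then obtain g where g: "small_diffs l K g" and fg: "\<And>n. f (Suc n) = f n + of_int l * g n"
    by auto
  from Suc.IH[OF g] obtain c where c: "\<And>j. c j \<in> integral_at l"
    and gc: "\<And>n. n \<le> K \<Longrightarrow> g n = (\<Sum>j\<le>K. of_nat (n choose j) * of_int l ^ j * c j)" by blast
  \<comment> \<open>The differences of \<open>f\<close> at \<open>0\<close> are \<open>f 0\<close>
    followed by \<open>l\<close> times those of \<open>g\<close>; Pascal's rule then carries the
    induction on \<open>n\<close>.\<close>
  define d where "d j = (case j of 0 \<Rightarrow> f 0 | Suc i \<Rightarrow> c i)" for j
  have "f n = (\<Sum>j\<le>Suc K. of_nat (n choose j) * of_int l ^ j * d j)" if "n \<le> Suc K" for n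
    using that
  proof (induction n)
    case 0
    have "(\<Sum>j\<le>K. of_nat (0 choose Suc j) * of_int l ^ Suc j * d (Suc j)) = 0" by simp
    then show ?case unfolding sum.atMost_Suc_shift by (simp add: d_def)
  next
    case (Suc n)
    have "f (Suc n) = (\<Sum>j\<le>Suc K. of_nat (n choose j) * of_int l ^ j * d j)
        + of_int l * (\<Sum>j\<le>K. of_nat (n choose j) * of_int l ^ j * c j)"
      using Suc gc[of n] fg[of n] by simp
    also have "\<dots> = (\<Sum>j\<le>Suc K. of_nat (Suc n choose j) * of_int l ^ j * d j)"
      unfolding sum.atMost_Suc_shift
      by (simp add: d_def sum_distrib_left sum.distrib algebra_simps)
    finally show ?case .
  qed
  moreover have "d j \<in> integral_at l" for j
    using c Suc.prems by (auto simp: d_def split: nat.splits)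
  ultimately show ?case by blast
qed

text \<open>
  The factor \<open>n\<close> comes from summing the binomial coefficients of Newton's formula; the denominator
  \<open>j + 1\<close> that this introduces costs less than \<open>l ^ j\<close> except for \<open>j = 0\<close> and, if \<open>l = 2\<close>, for
  \<open>j = 1\<close>, which is why divisibility of the values by \<open>l\<^sup>2\<close> is needed as well.
\<close>

lemma small_diffs_sum:
  assumes l: "prime l" and h: "\<And>k. small_diffs l k h"
    and sq: "\<And>n. \<exists>y\<in>integral_at l. h n = of_int l ^ 2 * y"
  shows "\<exists>y\<in>integral_at l. (\<Sum>i<n. h i) = of_nat n * of_int l * y"
proof -
  have "l > 0" using l prime_gt_0_int by blast
  \<comment> \<open>The extra \<open>1\<close> makes the expansion available at \<open>0\<close> and
    \<open>1\<close> for every \<open>n\<close>, also for \<open>n = 0\<close>.\<close>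
  define K where "K = Suc n"
  obtain c where c: "\<And>j. c j \<in> integral_at l"
    and hc: "\<And>i. i \<le> K \<Longrightarrow> h i = (\<Sum>j\<le>K. of_nat (i choose j) * of_int l ^ j * c j)"
    using small_diffs_newton[OF l h[of K]] by blast
  obtain y0 where y0: "y0 \<in> integral_at l" "h 0 = of_int l ^ 2 * y0" using sq by blast
  obtain y1 where y1: "y1 \<in> integral_at l" "h 1 = of_int l ^ 2 * y1" using sq by blast
  have "h 0 = c 0"
    using hc[of 0] unfolding K_def sum.atMost_Suc_shift by simp
  have h1: "h 1 = c 0 + of_int l * c 1"
  proof -
    have "(\<Sum>j<n. of_nat (1 choose Suc (Suc j)) * of_int l ^ Suc (Suc j) * c (Suc (Suc j))) = 0"
      by simp
    then show ?thesis
      using hc[of 1] unfolding K_def sum.atMost_Suc_shift 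
      by (simp add: sum.atMost_shift)
  qed
  \<comment> \<open>Both \<open>c 0 = h 0\<close> and \<open>c 0 + l c 1 = h 1\<close> are divisible
    by \<open>l^2\<close>, so \<open>c 1\<close> gains a factor \<open>l\<close>. It is what remains
    for \<open>j = 1\<close> when \<open>l = 2\<close> and the division by \<open>j + 1\<close>
    consumes the factor \<open>l ^ 1\<close>.\<close>
  then have c1: "c 1 = of_int l * (y1 - y0)"
  proof -
    have "of_int l * c 1 = of_int l * (of_int l * (y1 - y0))"
      using \<open>h 0 = c 0\<close> h1 y0 y1 by (simp add: power2_eq_square algebra_simps)
    then show ?thesis using \<open>l > 0\<close> by simp
  qed
  define b where "b j = of_int l ^ j * c j / of_nat (Suc j)" for j
  have b: "\<exists>y\<in>integral_at l. b j = of_int l * y" for j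
  proof -
    consider "j = 0" | "j = 1" | "j \<ge> 2" by linarith
    then show ?thesis
    proof cases
      case 1
      then have "b j = of_int l * (of_int l * y0)"
        using \<open>h 0 = c 0\<close> y0 by (simp add: b_def power2_eq_square)
      then show ?thesis using l y0 by (blast intro: integral_at_intros)
    next
      case 2
      have "b j = of_int l * ((of_int l ^ 1 / of_nat (Suc 1)) * (y1 - y0))"
        using 2 c1 by (simp add: b_def)
      then show ?thesis using l y0 y1 prime_power_div_Suc(1)[OF l, of 1] by (blast intro: integral_at_intros)
    next
      case 3
      have "of_int l ^ j = (of_int l * of_int l ^ (j - 1) :: rat)"
        using 3 by (simp flip: power_Suc)
      then have "b j = of_int l * ((of_int l ^ (j - 1) / of_nat (Suc j)) * c j)"
        by (simp add: b_def)
      then show ?thesis using l c prime_power_div_Suc(2)[OF l 3] by (blast intro: integral_at_intros)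
    qed
  qed
  then obtain y where y: "\<And>j. y j \<in> integral_at l" "\<And>j. b j = of_int l * y j" by metis
  have choose_sum: "(\<Sum>i<n. of_nat (i choose j)) = (of_nat (n choose Suc j) :: rat)" for j
    by (induction n) (simp_all)
  \<comment> \<open>For \<open>n = 0\<close> both sides vanish, so the truncated
    \<open>n - 1\<close> does no harm.\<close>
  have choose_Suc: "of_nat (n choose Suc j) = (of_nat n * of_nat ((n - 1) choose j) / of_nat (Suc j) :: rat)" for j
  proof (cases n)
    case (Suc n')
    have "of_nat (Suc j) * of_nat (Suc n' choose Suc j) = (of_nat (Suc n') * of_nat (n' choose j) :: rat)"
      by (metis Suc_times_binomial of_nat_mult)
    then show ?thesis
      unfolding Suc by (simp add: eq_divide_eq mult.commute del: of_nat_Suc binomial_Suc_Suc)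
  qed simp
  have "(\<Sum>i<n. h i) = (\<Sum>i<n. \<Sum>j\<le>K. of_nat (i choose j) * of_int l ^ j * c j)"
    using hc by (intro sum.cong) (auto simp: K_def)
  also have "\<dots> = (\<Sum>j\<le>K. of_nat (n choose Suc j) * (of_int l ^ j * c j))"
    by (subst sum.swap) (simp add: sum_distrib_right mult.assoc flip: choose_sum)
  also have "\<dots> = (\<Sum>j\<le>K. of_nat n * (of_nat ((n - 1) choose j) * b j))"
    by (simp add: choose_Suc b_def mult.assoc)
  also have "\<dots> = of_nat n * of_int l * (\<Sum>j\<le>K. of_nat ((n - 1) choose j) * y j)"
    by (simp add: y sum_distrib_left algebra_simps)
  finally show ?thesis
    using l y by (blast intro: integral_at_sum integral_at_intros)
qed

section \<open>Points in the kernel of reduction\<close>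

definition ideal_at :: "int \<Rightarrow> nat \<Rightarrow> rat set" where
  "ideal_at l k = (\<lambda>y. of_int l ^ k * y) ` integral_at l"

lemma ideal_at_0 [simp]: "ideal_at l 0 = integral_at l"
  by (simp add: ideal_at_def)

lemma ideal_at_integral:
  assumes "prime l" "x \<in> ideal_at l k" shows "x \<in> integral_at l"
  using assms unfolding ideal_at_def by (auto intro: integral_at_intros)

lemma zero_in_ideal_at: "prime l \<Longrightarrow> 0 \<in> ideal_at l k"
  unfolding ideal_at_def using integral_at_0 by force

lemma ideal_at_add:
  assumes "prime l" "x \<in> ideal_at l k" "y \<in> ideal_at l k" shows "x + y \<in> ideal_at l k"
  using assms unfolding ideal_at_def
  by (auto simp flip: distrib_left intro!: imageI integral_at_add)

lemma ideal_at_mult: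
  assumes "prime l" "x \<in> ideal_at l j" "y \<in> ideal_at l k" shows "x * y \<in> ideal_at l (j + k)"
proof -
  obtain x' y' where "x' \<in> integral_at l" "y' \<in> integral_at l"
    and "x = of_int l ^ j * x'" "y = of_int l ^ k * y'"
    using assms unfolding ideal_at_def by blast
  then have "x * y = of_int l ^ (j + k) * (x' * y')" "x' * y' \<in> integral_at l"
    using assms(1) by (auto simp: power_add mult_ac intro: integral_at_mult)
  then show ?thesis unfolding ideal_at_def by blast
qed

lemma ideal_at_scale:
  assumes "prime l" "x \<in> integral_at l" "y \<in> ideal_at l k" shows "x * y \<in> ideal_at l k"
  using ideal_at_mult[of l x 0 y k] assms by simp

lemma ideal_at_uminus: "prime l \<Longrightarrow> x \<in> ideal_at l k \<Longrightarrow> - x \<in> ideal_at l k"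
  using ideal_at_scale[of l "- 1" x k] integral_at_of_int[of l "- 1"] by simp

lemma ideal_at_diff:
  "prime l \<Longrightarrow> x \<in> ideal_at l k \<Longrightarrow> y \<in> ideal_at l k \<Longrightarrow> x - y \<in> ideal_at l k"
  using ideal_at_add[of l x k "- y"] ideal_at_uminus[of l y k] by simp

lemma ideal_at_mono:
  assumes "prime l" "x \<in> ideal_at l k" "j \<le> k" shows "x \<in> ideal_at l j"
proof -
  obtain y where y: "y \<in> integral_at l" "x = of_int l ^ k * y"
    using assms unfolding ideal_at_def by blast
  then have "x = of_int l ^ j * (of_int l ^ (k - j) * y)"
    using assms(3) by (simp flip: mult.assoc power_add)
  then show ?thesis
    using y assms(1) unfolding ideal_at_def by (blast intro: integral_at_intros)
qed

lemma ideal_at_unit: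
  assumes "prime l" "x \<in> ideal_at l (Suc k)"
  shows "1 + x \<noteq> 0" "1 / (1 + x) \<in> integral_at l"
proof -
  obtain y where "y \<in> integral_at l" "x = of_int l ^ 1 * y"
    using ideal_at_mono[OF assms, of 1] unfolding ideal_at_def by auto
  then show "1 + x \<noteq> 0" "1 / (1 + x) \<in> integral_at l"
    using integral_at_unit[OF assms(1)] by auto
qed

text \<open>
  In the coordinates \<open>z = u / v\<close>, \<open>w = 1 / v\<close> around the point at infinity the curve becomes
  \<open>w = z\<^sup>3 + a z\<^sup>2 w + b z w\<^sup>2\<close>, and \<open>chord_slope\<close> below is the slope of the chord
  through two of its points as well as of the tangent at a single one.
\<close>

fun z_coord :: "ec_point \<Rightarrow> rat" where
  "z_coord Infinity = 0"
| "z_coord (Affine u v) = u / v"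

fun w_coord :: "ec_point \<Rightarrow> rat" where
  "w_coord Infinity = 0"
| "w_coord (Affine u v) = 1 / v"

definition chord_slope :: "rat \<Rightarrow> rat \<Rightarrow> rat \<Rightarrow> rat \<Rightarrow> rat \<Rightarrow> rat \<Rightarrow> rat" where
  "chord_slope a b z1 w1 z w =
     (z^2 + z * z1 + z1^2 + a * (z + z1) * w1 + b * w1^2) / (1 - a * z^2 - b * z * (w + w1))"

lemma curve_zw:
  fixes a b u v :: rat
  assumes "v^2 = u^3 + a * u^2 + b * u" "v \<noteq> 0" "z = u / v" "w = 1 / v"
  shows "w = z^3 + a * z^2 * w + b * z * w^2"
proof -
  have "z^3 + a * z^2 * w + b * z * w^2 = (u^3 + a * u^2 + b * u) / v^3"
    using assms(2) by (simp add: assms(3,4) field_simps power2_eq_square power3_eq_cube)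
  also have "\<dots> = v^2 / v^3" by (simp only: assms(1))
  also have "\<dots> = w"
    using assms(2) by (simp add: assms(4) power2_eq_square power3_eq_cube)
  finally show ?thesis by simp
qed

lemma curve_zw_coord:
  assumes "Q \<in> carrier (ec_group a b)" "\<And>u. Q \<noteq> Affine u 0"
  shows "w_coord Q = z_coord Q^3 + a * z_coord Q^2 * w_coord Q + b * z_coord Q * w_coord Q^2"
proof (cases Q)
  case (Affine u v)
  then have "v^2 = u^3 + a * u^2 + b * u" "v \<noteq> 0"
    using assms by (auto simp: ec_group_def)
  then show ?thesis by (rule curve_zw) (simp_all add: Affine)
qed simp

text \<open>Subtracting the two curve equations and splitting off \<open>z - z1\<close> gives the
  slope; no denominator \<open>z - z1\<close> remains, so the formula survives at
  \<open>z = z1\<close>. The last three conclusions are Vieta's relations for the cubic in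
  \<open>z\<close> obtained by substituting \<open>w = lam z + nu\<close>, with leading coefficient
  \<open>D\<close> and third root \<open>z3\<close>.\<close>

lemma chord_identities:
  fixes a b z1 w1 z w :: rat
  assumes curve: "w = z^3 + a * z^2 * w + b * z * w^2"
    and curve1: "w1 = z1^3 + a * z1^2 * w1 + b * z1 * w1^2"
    and den: "1 - a * z^2 - b * z * (w + w1) \<noteq> 0"
  defines "lam \<equiv> chord_slope a b z1 w1 z w"
  defines "nu \<equiv> w1 - lam * z1" and "D \<equiv> 1 + a * lam + b * lam^2"
  defines "z3 \<equiv> - (z + z1) - nu * (a + 2 * b * lam) / D"
  assumes D: "D \<noteq> 0"
  shows "lam * (1 - a * z^2 - b * z * (w + w1)) =
      z^2 + z * z1 + z1^2 + a * (z + z1) * w1 + b * w1^2"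
    and "w = lam * z + nu"
    and "D * (z + z1 + z3) = - nu * (a + 2 * b * lam)"
    and "D * (z * z1 + (z + z1) * z3) = b * nu^2 - lam"
    and "D * (z * z1 * z3) = nu"
proof -
  let ?den = "1 - a * z^2 - b * z * (w + w1)"
  show lam: "lam * ?den = z^2 + z * z1 + z1^2 + a * (z + z1) * w1 + b * w1^2"
    using den by (simp add: lam_def chord_slope_def)
  have "(w - w1) * ?den = (z - z1) * (z^2 + z * z1 + z1^2 + a * (z + z1) * w1 + b * w1^2)"
    using curve curve1 by algebra
  also have "\<dots> = (lam * (z - z1)) * ?den" by (simp flip: lam)
  finally have "w - w1 = lam * (z - z1)" using den by simp
  then show w: "w = lam * z + nu" by (simp add: nu_def algebra_simps)
  have w1: "w1 = lam * z1 + nu" by (simp add: nu_def)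
  show e1: "D * (z + z1 + z3) = - nu * (a + 2 * b * lam)"
    using D by (simp add: z3_def field_simps)
  \<comment> \<open>Given the sum of the roots, the second relation follows from the equation for
    \<open>lam\<close>; thus no double root has to be discussed when \<open>z = z1\<close>.\<close>
  have "D * (z * z1 + (z + z1) * z3) = D * z * z1 + (z + z1) * (D * (z + z1 + z3) - D * (z + z1))"
    by (simp add: algebra_simps)
  also have "\<dots> = b * nu^2 - lam"
    unfolding e1 unfolding D_def using lam unfolding w w1 by algebra
  finally show e2: "D * (z * z1 + (z + z1) * z3) = b * nu^2 - lam" .
  \<comment> \<open>The third relation then expresses that \<open>z1\<close> is a root of the
    cubic.\<close>
  have "D * (z * z1 * z3) =
      D * z1^3 - D * (z + z1 + z3) * z1^2 + D * (z * z1 + (z + z1) * z3) * z1"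
    by (simp add: algebra_simps power2_eq_square power3_eq_cube)
  also have "\<dots> = nu"
    unfolding e1 e2 unfolding D_def using curve1 unfolding w1 by algebra
  finally show "D * (z * z1 * z3) = nu" .
qed

text \<open>Three collinear points sum to the origin, which is the point at infinity, and negation
  is \<open>(z, w)\<close> to \<open>(- z, - w)\<close>; hence \<open>R\<close> is the negative of
  the third intersection. Points \<open>Affine u 0\<close> are excluded because division by zero
  would give them the coordinates of infinity.\<close>

lemma ec_add_zw:
  fixes a b u1 v1 :: rat
  assumes Q: "Q \<in> carrier (ec_group a b)" "\<And>u. Q \<noteq> Affine u 0"
    and P: "v1^2 = u1^3 + a * u1^2 + b * u1" "u1 \<noteq> 0" "v1 \<noteq> 0"
    and z_def: "z = z_coord Q" and w_def: "w = w_coord Q"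
    and z1_def: "z1 = u1 / v1" and w1_def: "w1 = 1 / v1"
    and den: "1 - a * z^2 - b * z * (w + w1) \<noteq> 0"
    and lam_def: "lam = chord_slope a b z1 w1 z w"
    and nu_def: "nu = w1 - lam * z1"
    and D_def: "D = 1 + a * lam + b * lam^2" and D: "D \<noteq> 0"
    and R_def: "R = ec_add a b Q (Affine u1 v1)"
  shows "R \<noteq> Affine u 0"
    and "z_coord R = z + z1 + nu * (a + 2 * b * lam) / D"
    and "w_coord R = lam * z_coord R - nu"
proof -
  define z3 where "z3 = - (z + z1) - nu * (a + 2 * b * lam) / D"
  have curve1: "w1 = z1^3 + a * z1^2 * w1 + b * z1 * w1^2"
    by (rule curve_zw[OF P(1,3) z1_def w1_def])
  have curve: "w = z^3 + a * z^2 * w + b * z * w^2"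
    unfolding z_def w_def using Q by (rule curve_zw_coord)
  note ids = chord_identities[OF curve curve1 den, folded lam_def, folded nu_def D_def,
      folded z3_def, OF D]
  have [simp]: "z1 \<noteq> 0" "w1 \<noteq> 0" using P by (simp_all add: z1_def w1_def)
  have "R \<noteq> Affine u 0 \<and> z_coord R = - z3 \<and> w_coord R = - (lam * z3 + nu)"
  proof (cases Q)
    case Infinity
    then have zw: "z = 0" "w = 0" by (simp_all add: z_def w_def)
    with ids(2) have "nu = 0" by simp
    moreover from this zw ids(3) D have "z3 = - z1" by (simp add: add_eq_0_iff)
    moreover from \<open>nu = 0\<close> have "w1 = lam * z1" by (simp add: nu_def)
    ultimately show ?thesis using P Infinity by (simp add: R_def z1_def w1_def)
  next
    case (Affine u' v)
    then have uv: "v^2 = u'^3 + a * u'^2 + b * u'" "v \<noteq> 0" "z = u' / v" "w = 1 / v"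
      using Q by (auto simp: ec_group_def z_def w_def)
    then have "w \<noteq> 0" by simp
    show ?thesis
    proof (cases "nu = 0")
      \<comment> \<open>The line passes through the origin, which is then the third intersection,
        and the sum is infinity.\<close>
      case True
      have lz: "w = lam * z" "w1 = lam * z1" using ids(2) True by (auto simp: nu_def)
      then have "lam \<noteq> 0" "z \<noteq> 0" using \<open>w \<noteq> 0\<close> by auto
      then have "z3 = 0" using ids(5) True D by simp
      then have "z = - z1" using ids(3) True D by (simp add: add_eq_0_iff)
      then have "w = - w1" using lz by simp
      then have "v = - v1" using uv P by (simp add: w1_def field_simps)
      moreover have "u' = u1"
        using \<open>z = - z1\<close> \<open>v = - v1\<close> uv P by (simp add: z1_def)
      ultimately have "R = Infinity" by (simp add: R_def Affine)
      then show ?thesis using \<open>z3 = 0\<close> True by simp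
    next
      case False
      \<comment> \<open>Multiplying \<open>w = lam z + nu\<close> by \<open>v\<close> gives the same
        line in affine coordinates. Its slope there is \<open>- lam / nu\<close>, to be matched with
        the slope \<open>s\<close> of \<open>ec_add\<close>.\<close>
      have line: "lam * u' + nu * v = 1"
      proof -
        have "lam * u' + nu * v = (lam * z + nu) * v"
          using uv(2) by (simp add: uv(3) algebra_simps)
        also have "\<dots> = w * v" by (simp only: ids(2)[symmetric])
        finally show ?thesis using uv(2,4) by simp
      qed
      have line1: "lam * u1 + nu * v1 = 1"
        using P by (simp add: nu_def z1_def w1_def field_simps)
      have ne: "\<not> (u' = u1 \<and> v = - v1)"
      proof
        assume "u' = u1 \<and> v = - v1"
        then have "w + w1 = 0" "z + z1 = 0" by (simp_all add: uv z1_def w1_def)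
        moreover have "w + w1 = lam * (z + z1) + 2 * nu"
          using ids(2) by (simp add: nu_def algebra_simps)
        ultimately show False using False by simp
      qed
      define s where "s = (if u' = u1 then (3 * u'^2 + 2 * a * u' + b) / (2 * v)
          else (v1 - v) / (u1 - u'))"
      have s: "s = - lam / nu"
      proof (cases "u' = u1")
        case True
        then have "nu * v = nu * v1" using line line1 unfolding True by linarith
        then have "v = v1" using False by simp
        then have eq: "z1 = z" "w1 = w" using True uv by (simp_all add: z1_def w1_def)
        have "lam * (1 - a * z^2 - b * z * (w + w)) =
            z^2 + z * z + z^2 + a * (z + z) * w + b * w^2"
          using ids(1) eq by simp
        moreover have "w * v = 1" "u' = z * v" using uv(2-4) by simp_all
        ultimately have lam: "lam * (v^2 - a * u'^2 - 2 * b * u') = 3 * u'^2 + 2 * a * u' + b"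
          by algebra
        have "v * (nu * (3 * u'^2 + 2 * a * u' + b) + 2 * lam * v) = 0"
          using lam line uv(1) by algebra
        then have "nu * (3 * u'^2 + 2 * a * u' + b) = - lam * (2 * v)"
          using uv(2) by (simp add: add_eq_0_iff)
        then show ?thesis using True False uv(2) by (simp add: s_def field_simps)
      next
        case F: False
        have "nu * (v1 - v) = - lam * (u1 - u')"
          using line line1 by (simp add: algebra_simps)
        then show ?thesis using F False by (simp add: s_def field_simps)
      qed
      define w3 where "w3 = lam * z3 + nu"
      have w1: "w1 = lam * z1 + nu" by (simp add: nu_def)
      \<comment> \<open>Vieta's relations for the \<open>z\<close> are turned into the product of
        the \<open>w\<close> and, in \<open>u3\<close>, into the sum of the abscissas
        \<open>z / w\<close>, which has to be \<open>s^2 - a\<close>.\<close>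
      have prod: "D * (w * w1 * w3) = nu^3"
      proof -
        have "D * (w * w1 * w3) = lam^3 * (D * (z * z1 * z3)) +
            lam^2 * nu * (D * (z * z1 + (z + z1) * z3)) + lam * nu^2 * (D * (z + z1 + z3)) + D * nu^3"
          unfolding w1 ids(2) w3_def
          by (simp add: algebra_simps power2_eq_square power3_eq_cube)
        also have "\<dots> = nu^3" unfolding ids(3-5) unfolding D_def by algebra
        finally show ?thesis .
      qed
      then have "w3 \<noteq> 0" using False by auto
      have u3: "s^2 - a - u' - u1 = z3 / w3"
      proof -
        have "D * (z * w1 * w3 + z1 * w * w3 + z3 * w * w1) =
            3 * lam^2 * (D * (z * z1 * z3)) + 2 * lam * nu * (D * (z * z1 + (z + z1) * z3))
              + nu^2 * (D * (z + z1 + z3))"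
          unfolding w1 ids(2) w3_def
          by (simp add: algebra_simps power2_eq_square power3_eq_cube)
        also have "\<dots> = lam^2 * nu - a * nu^3" unfolding ids(3-5) by algebra
        finally have sum: "D * (z * w1 * w3 + z1 * w * w3 + z3 * w * w1) = lam^2 * nu - a * nu^3" .
        have "z / w + z1 / w1 + z3 / w3 =
            D * (z * w1 * w3 + z1 * w * w3 + z3 * w * w1) / (D * (w * w1 * w3))"
          using D \<open>w \<noteq> 0\<close> \<open>w3 \<noteq> 0\<close> by (simp add: field_simps)
        also have "\<dots> = s^2 - a"
          unfolding sum prod using False
          by (simp add: s field_simps power2_eq_square power3_eq_cube)
        finally show ?thesis using uv P by (simp add: z1_def w1_def)
      qed
      have v3: "s * (u' - z3 / w3) - v = - 1 / w3"
      proof -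
        have "nu * (s * (u' - z3 / w3) - v) = lam * z3 / w3 - (lam * u' + nu * v)"
          using False by (simp add: s algebra_simps)
        also have "\<dots> = nu * (- 1 / w3)"
          unfolding line using \<open>w3 \<noteq> 0\<close> w3_def by (simp add: field_simps)
        finally show ?thesis by (rule mult_left_cancel[OF False, THEN iffD1])
      qed
      have "R = Affine (z3 / w3) (- 1 / w3)"
        unfolding R_def Affine ec_add.simps Let_def s_def[symmetric] u3 v3 using ne by simp
      then show ?thesis using \<open>w3 \<noteq> 0\<close> by (simp add: w3_def)
    qed
  qed
  then show "R \<noteq> Affine u 0" and "z_coord R = z + z1 + nu * (a + 2 * b * lam) / D"
    and "w_coord R = lam * z_coord R - nu"
    by (simp_all add: z3_def algebra_simps)
qed

text \<open>Vieta's relations again, for the cubic cut out by the line \<open>v = l u + e\<close>.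
  Chord and tangent differ only in the proof of the second relation \<open>key\<close>; the third
  follows because \<open>u1\<close> is a root.\<close>

lemma ec_add_closed:
  assumes "P \<in> carrier (ec_group a b)" "Q \<in> carrier (ec_group a b)"
  shows "ec_add a b P Q \<in> carrier (ec_group a b)"
proof (cases "(a, b, P, Q)" rule: ec_add.cases)
  case (3 a' b' u1 v1 u2 v2)
  then have 1: "v1^2 = u1^3 + a * u1^2 + b * u1" and 2: "v2^2 = u2^3 + a * u2^2 + b * u2"
    using assms by (auto simp: ec_group_def)
  show ?thesis
  proof (cases "u1 = u2 \<and> v1 = - v2")
    case True
    then show ?thesis using 3 by (simp add: ec_group_def)
  next
    case False
    define l where "l = (if u1 = u2 then (3 * u1^2 + 2 * a * u1 + b) / (2 * v1)
        else (v2 - v1) / (u2 - u1))"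
    define u3 where "u3 = l^2 - a - u1 - u2"
    define e where "e = v1 - l * u1"
    have key: "2 * l * e = b - (u1 * u2 + u1 * u3 + u2 * u3)"
    proof (cases "u1 = u2")
      case True
      then have "v1^2 = v2^2" using 1 2 by simp
      then have "v1 = v2" using True False by (auto simp: power2_eq_iff)
      then have "v1 \<noteq> 0" using True False by auto
      then have "l * (2 * v1) = 3 * u1^2 + 2 * a * u1 + b" using True by (simp add: l_def)
      then show ?thesis unfolding e_def u3_def True[symmetric] by algebra
    next
      case F: False
      then have l: "v2 - v1 = l * (u2 - u1)" by (simp add: l_def)
      have "(u2 - u1) * (2 * l * e) = (u2 - u1) * (b - (u1 * u2 + u1 * u3 + u2 * u3))"
        unfolding e_def u3_def using 1 2 l by algebra
      then show ?thesis using F by simp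
    qed
    have "v1 = l * u1 + e" by (simp add: e_def)
    have a: "a = l^2 - (u1 + u2 + u3)" by (simp add: u3_def)
    have "(l * u1 + e)^2 = u1^3 + a * u1^2 + b * u1" using 1 \<open>v1 = _\<close> by simp
    then have "e^2 = u1 * u2 * u3" using key unfolding a by algebra
    then have "(l * u3 + e)^2 = u3^3 + a * u3^2 + b * u3" using key unfolding a by algebra
    moreover have "l * (u1 - u3) - v1 = - (l * u3 + e)" by (simp add: e_def algebra_simps)
    ultimately have "(l * (u1 - u3) - v1)^2 = u3^3 + a * u3^2 + b * u3"
      by (simp only: power2_minus)
    moreover have "ec_add a b P Q = Affine u3 (l * (u1 - u3) - v1)"
    proof -
      have "P = Affine u1 v1" "Q = Affine u2 v2" using 3 by auto
      then show ?thesis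
        unfolding u3_def l_def using False by (simp add: Let_def)
    qed
    ultimately show ?thesis by (simp add: ec_group_def)
  qed
qed (use assms in \<open>auto simp: ec_group_def\<close>)

section \<open>Multiples of a point that reduces to infinity\<close>

lemma ideal_at_1_mult:
  "prime l \<Longrightarrow> x \<in> ideal_at l 1 \<Longrightarrow> y \<in> ideal_at l 1 \<Longrightarrow> x * y \<in> ideal_at l 2"
  using ideal_at_mult[of l x 1 y 1] by (simp add: numeral_2_eq_2)

text \<open>The numerator of the slope is homogeneous of degree two in quantities divisible by
  \<open>l\<close>, and the denominator is \<open>1\<close> modulo \<open>l^2\<close>.\<close>

lemma chord_slope_integral:
  assumes l: "prime l" and ab: "a \<in> integral_at l" "b \<in> integral_at l"
    and zw1: "z1 \<in> ideal_at l 1" "w1 \<in> ideal_at l 1"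
    and zw: "z \<in> ideal_at l 1" "w \<in> ideal_at l 1"
  shows "1 - a * z^2 - b * z * (w + w1) \<noteq> 0"
    and "1 / (1 - a * z^2 - b * z * (w + w1)) \<in> integral_at l"
    and "chord_slope a b z1 w1 z w \<in> ideal_at l 2"
proof -
  note I = ideal_at_add[OF l] ideal_at_diff[OF l] ideal_at_uminus[OF l] ideal_at_scale[OF l]
    ideal_at_1_mult[OF l]
  have "- a * z^2 - b * (z * (w + w1)) \<in> ideal_at l (Suc 1)"
    unfolding Suc_1 power2_eq_square using ab zw zw1 l
    by (intro I integral_at_uminus)
  from ideal_at_unit[OF l this]
  show "1 - a * z^2 - b * z * (w + w1) \<noteq> 0"
    and unit: "1 / (1 - a * z^2 - b * z * (w + w1)) \<in> integral_at l"
    by (simp_all add: algebra_simps)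
  have "z^2 + z * z1 + z1^2 + a * ((z + z1) * w1) + b * w1^2 \<in> ideal_at l 2"
    unfolding power2_eq_square using ab zw zw1 by (intro I)
  from ideal_at_scale[OF l unit this]
  show "chord_slope a b z1 w1 z w \<in> ideal_at l 2"
    by (simp add: chord_slope_def mult.assoc)
qed

lemma slope_unit:
  assumes l: "prime l" and ab: "a \<in> integral_at l" "b \<in> integral_at l" and "lam \<in> ideal_at l 2"
  shows "1 + a * lam + b * lam^2 \<noteq> 0" "1 / (1 + a * lam + b * lam^2) \<in> integral_at l"
proof -
  have "lam \<in> integral_at l" using ideal_at_integral[OF l] assms(4) by blast
  then have "a * lam + b * lam * lam \<in> ideal_at l (Suc 1)"
    unfolding Suc_1 using ab assms(4) l
    by (intro ideal_at_add ideal_at_scale integral_at_mult)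
  from ideal_at_unit[OF l this]
  show "1 + a * lam + b * lam^2 \<noteq> 0" "1 / (1 + a * lam + b * lam^2) \<in> integral_at l"
    by (simp_all add: power2_eq_square algebra_simps)
qed

lemma ec_pow_0: "(P [^]\<^bsub>ec_group a b\<^esub> (0::nat)) = Infinity"
  by (simp add: nat_pow_def ec_group_def)

lemma ec_pow_Suc:
  "(P [^]\<^bsub>ec_group a b\<^esub> Suc n) = ec_add a b (P [^]\<^bsub>ec_group a b\<^esub> n) P"
  by (simp add: nat_pow_def ec_group_def)

text \<open>The case \<open>l = 2\<close> has to be included: for \<open>m = 2\<close> it is the
  only prime dividing the numerator.\<close>

lemma kernel_of_reduction_pow_neq_Infinity:
  fixes a b u1 v1 :: rat and n :: nat
  assumes l: "prime l" and ab: "a \<in> integral_at l" "b \<in> integral_at l"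
    and P: "v1^2 = u1^3 + a * u1^2 + b * u1" "u1 \<noteq> 0" "v1 \<noteq> 0"
    and zw1: "u1 / v1 \<in> ideal_at l 1" "1 / v1 \<in> ideal_at l 1"
    and "n > 0"
  shows "Affine u1 v1 [^]\<^bsub>ec_group a b\<^esub> n \<noteq> Infinity"
proof -
  define X where "X n = Affine u1 v1 [^]\<^bsub>ec_group a b\<^esub> n" for n :: nat
  have X0: "X 0 = Infinity" and XSuc: "X (Suc n) = ec_add a b (X n) (Affine u1 v1)" for n
    unfolding X_def by (fact ec_pow_0 ec_pow_Suc)+
  define z1 w1 where "z1 = u1 / v1" and "w1 = 1 / v1"
  define z w where "z n = z_coord (X n)" and "w n = w_coord (X n)" for n
  define lam where "lam n = chord_slope a b z1 w1 (z n) (w n)" for n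
  define nu where "nu n = w1 - lam n * z1" for n
  define D where "D n = 1 + a * lam n + b * (lam n)^2" for n
  have zw1: "z1 \<in> ideal_at l 1" "w1 \<in> ideal_at l 1"
    using zw1 by (simp_all add: z1_def w1_def)
  note slope = chord_slope_integral[OF l ab zw1]
  have nu_id: "x \<in> ideal_at l 2 \<Longrightarrow> w1 - x * z1 \<in> ideal_at l 1" for x
    using zw1 l by (intro ideal_at_diff ideal_at_scale) (auto intro: ideal_at_integral)
  have integral: "x \<in> ideal_at l k \<Longrightarrow> x \<in> integral_at l" for x k
    using l by (rule ideal_at_integral)
  have step: "z (Suc n) = z n + z1 + nu n * (a + 2 * b * lam n) / D n"
      "w (Suc n) = lam n * z (Suc n) - nu n" "\<And>u. X (Suc n) \<noteq> Affine u 0"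
    if n: "X n \<in> carrier (ec_group a b)" "\<And>u. X n \<noteq> Affine u 0"
      "z n \<in> ideal_at l 1" "w n \<in> ideal_at l 1" for n
  proof -
    have "lam n \<in> ideal_at l 2" unfolding lam_def using slope(3) n(3,4) by blast
    note ec_add_zw[OF n(1,2) P z_def w_def z1_def w1_def slope(1)[OF n(3,4)] lam_def nu_def
        D_def slope_unit(1)[OF l ab this, folded D_def] XSuc[of n]]
    then show "z (Suc n) = z n + z1 + nu n * (a + 2 * b * lam n) / D n"
      "w (Suc n) = lam n * z (Suc n) - nu n" "\<And>u. X (Suc n) \<noteq> Affine u 0"
      by (auto simp: z_def w_def)
  qed
  have Pc: "Affine u1 v1 \<in> carrier (ec_group a b)" using P by (simp add: ec_group_def)
  have inv: "X n \<in> carrier (ec_group a b) \<and> (\<forall>u. X n \<noteq> Affine u 0) \<and>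
      z n \<in> ideal_at l 1 \<and> w n \<in> ideal_at l 1" for n
  proof (induction n)
    case 0
    then show ?case using l by (simp add: X0 z_def w_def zero_in_ideal_at) (simp add: ec_group_def)
  next
    case (Suc n)
    then have n: "X n \<in> carrier (ec_group a b)" "\<And>u. X n \<noteq> Affine u 0"
      "z n \<in> ideal_at l 1" "w n \<in> ideal_at l 1" by auto
    have lam: "lam n \<in> ideal_at l 2" unfolding lam_def using slope(3) n(3,4) by blast
    then have nu: "nu n \<in> ideal_at l 1" unfolding nu_def by (rule nu_id)
    have "((a + 2 * b * lam n) * (1 / D n)) * nu n \<in> ideal_at l 1"
      using l ab nu slope_unit(2)[OF l ab lam] integral[OF lam] unfolding D_def
      by (intro ideal_at_scale integral_at_intros)
    then have z: "z (Suc n) \<in> ideal_at l 1"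
      unfolding step(1)[OF n] using l n(3) zw1 by (intro ideal_at_add) (simp_all add: mult_ac)
    moreover have "w (Suc n) \<in> ideal_at l 1"
      unfolding step(2)[OF n] using l nu z integral[OF lam] by (intro ideal_at_diff ideal_at_scale)
    moreover have "X (Suc n) \<in> carrier (ec_group a b)"
      unfolding XSuc using n(1) Pc by (rule ec_add_closed)
    ultimately show ?case using step(3)[OF n] by blast
  qed
  have zw: "z n \<in> ideal_at l 1" "w n \<in> ideal_at l 1" for n using inv by blast+
  have lam: "lam n \<in> ideal_at l 2" for n unfolding lam_def using slope(3) zw by blast
  note D = slope_unit[OF l ab lam, folded D_def]

  have den: "1 - a * z n^2 - b * z n * (w n + w1) \<noteq> 0"
    "1 / (1 - a * z n^2 - b * z n * (w n + w1)) \<in> integral_at l" for n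
    using slope(1,2) zw by blast+
  \<comment> \<open>The slope of the line from the origin to \<open>P\<close>, that is
    \<open>lam 0\<close>. Since \<open>w1 = z1 \<kappa>\<close>, the intercept \<open>nu\<close>,
    and with it every increment, carries the full factor \<open>z1\<close> and not merely
    \<open>l\<close>.\<close>
  define \<kappa> where "\<kappa> = z1^2 + a * (z1 * w1) + b * w1^2"
  have \<kappa>: "\<kappa> \<in> ideal_at l 2"
    unfolding \<kappa>_def power2_eq_square using ab zw1
    by (intro ideal_at_add[OF l] ideal_at_scale[OF l] ideal_at_1_mult[OF l])
  have curve1: "w1 = z1^3 + a * z1^2 * w1 + b * z1 * w1^2"
    by (rule curve_zw[OF P(1,3) z1_def w1_def])
  also have "\<dots> = z1 * \<kappa>" by (simp add: \<kappa>_def algebra_simps power2_eq_square power3_eq_cube)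
  finally have nu: "nu n = z1 * (\<kappa> - lam n)" for n by (simp add: nu_def algebra_simps)
  define h where "h n = (\<kappa> - lam n) * ((a + 2 * b * lam n) * (1 / D n))" for n
  have zSuc: "z (Suc n) = z n + z1 * (1 + h n)" for n
  proof -
    have "nu n * (a + 2 * b * lam n) / D n = z1 * h n" by (simp add: nu h_def mult.assoc)
    then show ?thesis using step(1)[of n] inv[of n] by (simp add: distrib_left)
  qed
  \<comment> \<open>Subtracting \<open>w n = lam n z n + nu n\<close> from
    \<open>w (n + 1) = lam n z (n + 1) - nu n\<close> shows the factor \<open>z1\<close> here too,
    so that \<open>w\<close> can join \<open>z\<close> in the induction on the level of
    differences.\<close>
  have wSuc: "w (Suc n) = w n + z1 * (lam n * (1 + h n) - 2 * (\<kappa> - lam n))" for n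
  proof -
    have curve: "w n = z n^3 + a * z n^2 * w n + b * z n * w n^2"
      unfolding z_def w_def using inv by (intro curve_zw_coord) blast+
    have "w n = lam n * z n + nu n"
      using chord_identities(2)[OF curve curve1 den(1) D(1)[of n, unfolded D_def lam_def]]
      by (simp add: lam_def nu_def)
    then show ?thesis
      using step(2)[of n] inv[of n] by (simp add: zSuc nu algebra_simps)
  qed
  have h_ideal: "\<exists>y\<in>integral_at l. h n = of_int l ^ 2 * y" for n
  proof -
    have "((a + 2 * b * lam n) * (1 / D n)) * (\<kappa> - lam n) \<in> ideal_at l 2"
      using l ab D(2) \<kappa> lam integral[OF lam]
      by (intro ideal_at_scale ideal_at_diff integral_at_intros)
    then show ?thesis unfolding ideal_at_def h_def by (auto simp: mult_ac)
  qed
  obtain \<zeta> where \<zeta>: "\<zeta> \<in> integral_at l" "z1 = of_int l * \<zeta>"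
    using zw1(1) unfolding ideal_at_def by auto
  have small_h: "small_diffs l k lam \<and> small_diffs l k h"
    if "small_diffs l k z" "small_diffs l k w" for k
  proof -
    have const: "x \<in> integral_at l \<Longrightarrow> small_diffs l k (\<lambda>_. x)" for x
      using l by (rule small_diffs_const)
    note S = const small_diffs_add[OF l] small_diffs_mult[OF l] small_diffs_diff[OF l]
      small_diffs_power[OF l] small_diffs_inverse[OF l]
    have c: "z1 \<in> integral_at l" "w1 \<in> integral_at l" "\<kappa> \<in> integral_at l" "1 \<in> integral_at l"
      "2 \<in> integral_at l"
      using zw1 \<kappa> integral l by (auto intro: integral_at_1 integral_at_numeral)
    have lam_eq: "lam = (\<lambda>n. (z n^2 + z n * z1 + z1^2 + a * (z n + z1) * w1 + b * w1^2) *
        (1 / (1 - a * z n^2 - b * z n * (w n + w1))))"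
      by (simp add: lam_def chord_slope_def fun_eq_iff)
    have sl: "small_diffs l k lam"
      unfolding lam_eq using that ab c den by (intro S)
    have "small_diffs l k D"
      unfolding D_def[abs_def] using sl ab c by (intro S)
    then have "small_diffs l k h"
      unfolding h_def[abs_def] using sl ab c D by (intro S)
    then show ?thesis using sl by blast
  qed
  \<comment> \<open>At level \<open>k\<close>, \<open>lam\<close> and \<open>h\<close> inherit
    smallness as rational functions of \<open>z\<close> and \<open>w\<close> with unit denominators;
    the increments of \<open>z\<close> and \<open>w\<close> are \<open>l\<close> times such
    functions, which gives level \<open>k + 1\<close>.\<close>
  have "small_diffs l k z \<and> small_diffs l k w" for k
  proof (induction k)
    case 0
    then show ?case using zw integral by auto
  next
    case (Suc k)
    then have lh: "small_diffs l k lam" "small_diffs l k h" using small_h by blast+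
    have const: "x \<in> integral_at l \<Longrightarrow> small_diffs l k (\<lambda>_. x)" for x
      using l by (rule small_diffs_const)
    note S = const small_diffs_add[OF l] small_diffs_mult[OF l] small_diffs_diff[OF l]
    have c: "\<kappa> \<in> integral_at l" "1 \<in> integral_at l" "2 \<in> integral_at l"
      using \<kappa> integral l by (auto intro: integral_at_1 integral_at_numeral)
    have "small_diffs l k (\<lambda>n. \<zeta> * (1 + h n))"
      using lh c \<zeta> by (intro S)
    moreover have "small_diffs l k (\<lambda>n. \<zeta> * (lam n * (1 + h n) - 2 * (\<kappa> - lam n)))"
      using lh c \<zeta> by (intro S)
    moreover have "z (Suc n) = z n + of_int l * (\<zeta> * (1 + h n))"
      and "w (Suc n) = w n + of_int l * (\<zeta> * (lam n * (1 + h n) - 2 * (\<kappa> - lam n)))" for n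
      unfolding zSuc wSuc \<zeta>(2) by (simp_all only: mult.assoc)
    moreover have "z n \<in> integral_at l" "w n \<in> integral_at l" for n
      using zw integral by blast+
    ultimately show ?case unfolding small_diffs.simps(2) by blast
  qed
  then have small_h: "small_diffs l k h" for k using small_h by blast
  obtain y where y: "y \<in> integral_at l" "(\<Sum>i<n. h i) = of_nat n * of_int l * y"
    using small_diffs_sum[of l h n, OF l small_h h_ideal] by blast
  have "z n = z1 * (of_nat n + (\<Sum>i<n. h i))" for n
    by (induction n) (simp_all add: zSuc algebra_simps, simp add: z_def X0)
  then have "z n = z1 * of_nat n * (1 + of_int l * y)"
    by (simp add: y algebra_simps)
  moreover have "1 + of_int l * y \<noteq> 0" using integral_at_unit(1)[OF l y(1)] .
  moreover have "z1 \<noteq> 0" using P by (simp add: z1_def)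
  ultimately have "z n \<noteq> 0" using \<open>n > 0\<close> by simp
  then show ?thesis by (auto simp: z_def X_def)
qed

section \<open>The rank of a group with a point of infinite order\<close>

text \<open>\<open>ec_group\<close> is not shown to be a commutative monoid, so the product over one
  element is read off from the inductive definition of \<open>foldSetD\<close>.\<close>

lemma finprod_singleton:
  assumes "f x \<in> carrier G" "f x \<otimes>\<^bsub>G\<^esub> \<one>\<^bsub>G\<^esub> = f x" "\<one>\<^bsub>G\<^esub> \<in> carrier G"
  shows "finprod G f {x} = f x"
proof -
  have empty: "y = \<one>\<^bsub>G\<^esub>" if "({}, y) \<in> foldSetD (carrier G) (mult G \<circ> f) \<one>\<^bsub>G\<^esub>" for y
    using that by (cases rule: foldSetD.cases) auto
  have fold: "({x}, (mult G \<circ> f) x \<one>\<^bsub>G\<^esub>) \<in> foldSetD (carrier G) (mult G \<circ> f) \<one>\<^bsub>G\<^esub>"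
    using assms by (intro foldSetD.intros) auto
  have unique: "y = f x" if "({x}, y) \<in> foldSetD (carrier G) (mult G \<circ> f) \<one>\<^bsub>G\<^esub>" for y
    using that
  proof (cases rule: foldSetD.cases)
    case (insertI x' A y')
    then have "x' = x" "A = {}" by auto
    then have "y' = \<one>\<^bsub>G\<^esub>" using insertI(5) empty \<open>A = {}\<close> by blast
    then show ?thesis using insertI(2) \<open>x' = x\<close> assms(2) by simp
  qed auto
  have "foldD (carrier G) (mult G \<circ> f) \<one>\<^bsub>G\<^esub> {x} = f x"
    unfolding foldD_def
  proof (rule the_equality)
    show "({x}, f x) \<in> foldSetD (carrier G) (mult G \<circ> f) \<one>\<^bsub>G\<^esub>"
      using fold by (simp add: assms(2))
  qed (rule unique)
  then show ?thesis by (simp add: finprod_def)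
qed

fun ec_neg :: "ec_point \<Rightarrow> ec_point" where
  "ec_neg Infinity = Infinity"
| "ec_neg (Affine u v) = Affine u (- v)"

lemma ec_add_eq_Infinity_iff: "ec_add a b P Q = Infinity \<longleftrightarrow> Q = ec_neg P"
  by (cases "(a, b, P, Q)" rule: ec_add.cases) (auto simp: Let_def)

lemma ec_neg_neg [simp]: "ec_neg (ec_neg P) = P"
  by (cases P) auto

text \<open>\<open>inv\<close> is a definite description; uniqueness holds because a sum is infinity
  only for opposite points.\<close>

lemma ec_inv:
  assumes "P \<in> carrier (ec_group a b)"
  shows "inv\<^bsub>ec_group a b\<^esub> P = ec_neg P"
proof -
  have "ec_neg P \<in> carrier (ec_group a b)"
    using assms by (cases P) (auto simp: ec_group_def)
  moreover have "ec_add a b P Q = Infinity \<and> ec_add a b Q P = Infinity \<longleftrightarrow> Q = ec_neg P" for Q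
    unfolding ec_add_eq_Infinity_iff by (metis ec_neg_neg)
  ultimately show ?thesis
    unfolding m_inv_def by (intro the_equality) (simp_all add: ec_group_def)
qed

text \<open>The singleton of \<open>P\<close> is independent: a relation with coefficient
  \<open>c\<close> makes the multiple of \<open>P\<close> by the absolute value of \<open>c\<close>
  infinite, after a negation if \<open>c < 0\<close>.\<close>

lemma abelian_rank_pos:
  assumes "non_torsion (ec_group a b) P"
  shows "abelian_rank (ec_group a b) > 0"
proof -
  let ?G = "ec_group a b"
  have P: "P \<in> carrier ?G" and nt: "\<And>n::nat. n > 0 \<Longrightarrow> P [^]\<^bsub>?G\<^esub> n \<noteq> Infinity"
    using assms by (auto simp: non_torsion_def ec_group_def)
  have pow: "P [^]\<^bsub>?G\<^esub> n \<in> carrier ?G" for n :: nat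
  proof (induction n)
    case 0
    show ?case unfolding ec_pow_0 by (simp add: ec_group_def)
  next
    case (Suc n)
    then show ?case unfolding ec_pow_Suc using P by (rule ec_add_closed)
  qed
  have neg: "ec_neg Q \<in> carrier ?G" if "Q \<in> carrier ?G" for Q
    using that by (cases Q) (auto simp: ec_group_def)
  have ipow: "P [^]\<^bsub>?G\<^esub> (c::int) =
      (if c < 0 then ec_neg (P [^]\<^bsub>?G\<^esub> nat (- c)) else P [^]\<^bsub>?G\<^esub> nat c)" for c
    by (subst int_pow_def2) (simp only: ec_inv[OF pow])
  have one: "\<one>\<^bsub>?G\<^esub> = Infinity" "Infinity \<in> carrier ?G" by (simp_all add: ec_group_def)
  have right_one: "Q \<otimes>\<^bsub>?G\<^esub> Infinity = Q" for Q by (cases Q) (simp_all add: ec_group_def)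
  have "c P = 0" if "finprod ?G (\<lambda>x. x [^]\<^bsub>?G\<^esub> c x) {P} = Infinity" for c :: "ec_point \<Rightarrow> int"
  proof (rule ccontr)
    assume "c P \<noteq> 0"
    define R where "R = P [^]\<^bsub>?G\<^esub> nat \<bar>c P\<bar>"
    have "R \<in> carrier ?G" unfolding R_def by (rule pow)
    have Pc: "P [^]\<^bsub>?G\<^esub> c P = (if c P < 0 then ec_neg R else R)"
      unfolding R_def by (subst ipow) auto
    have "P [^]\<^bsub>?G\<^esub> c P \<in> carrier ?G"
      unfolding Pc using \<open>R \<in> carrier ?G\<close> neg by simp
    then have "finprod ?G (\<lambda>x. x [^]\<^bsub>?G\<^esub> c x) {P} = P [^]\<^bsub>?G\<^esub> c P"
      by (intro finprod_singleton) (simp_all only: one right_one)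
    then have "(if c P < 0 then ec_neg R else R) = Infinity" using that Pc by metis
    then have "R = Infinity" by (metis ec_neg.simps(1) ec_neg_neg)
    then have "P [^]\<^bsub>?G\<^esub> nat \<bar>c P\<bar> = Infinity" by (simp only: R_def)
    then show False using nt[of "nat \<bar>c P\<bar>"] \<open>c P \<noteq> 0\<close> by simp
  qed
  then have "int_independent ?G {P}"
    unfolding int_independent_def one(1) using P by blast
  then have "enat (card {P}) \<le> abelian_rank ?G"
    unfolding abelian_rank_def by (intro SUP_upper) simp
  moreover have "enat (card {P}) > 0" by (simp add: zero_enat_def)
  ultimately show ?thesis by (rule less_le_trans[rotated])
qed

section \<open>The two families\<close>

lemma E_eq: "E N = ec_group (2 * (2 * N^2 + 2 * N - 1)) (- (4 * N - 1))"
  by (simp add: E_def)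

lemma Affine_in_E: "Affine u v \<in> carrier (E N) \<longleftrightarrow>
    v^2 = u^3 + 2 * (2 * N^2 + 2 * N - 1) * u^2 - (4 * N - 1) * u"
  by (simp add: E_def ec_group_def algebra_simps)

lemma T6_in_E: "T6 N \<in> carrier (E N)"
  unfolding T6_def Affine_in_E by algebra

text \<open>The choices \<open>c = e = 1\<close>, \<open>d = 3\<close> and
  \<open>c = d = e = - 1\<close> give the two families. When \<open>l\<close> divides the numerator
  of \<open>m\<close>, \<open>N\<close> is integral at \<open>l\<close> and \<open>k\<close> is a
  unit, being \<open>e\<close> modulo \<open>l\<close>.\<close>

lemma reciprocal_square_point_non_torsion:
  fixes m N k :: rat and c d e :: int
  assumes "m > 1" and N: "N = m^2 + of_int c" and k: "k = of_int e * (1 + of_int d * m^2)"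
    and e: "e * e = 1" and P: "Affine (1 / m^2) (k / m^3) \<in> carrier (E N)"
  shows "non_torsion (E N) (Affine (1 / m^2) (k / m^3))"
proof -
  obtain p q where pq: "quotient_of m = (p, q)" by fastforce
  have m: "m = of_int p / of_int q" "q > 0" "coprime p q"
    using quotient_of_div[OF pq] quotient_of_denom_pos[OF pq] quotient_of_coprime[OF pq] by auto
  then have "p > q" using \<open>m > 1\<close> by simp
  then have "p > 1" using m by simp
  then obtain l where l: "prime l" "l dvd p"
    using prime_factor_int[of p] by auto
  then have "\<not> l dvd q" using m(3) not_prime_unit coprime_common_divisor by blast
  obtain p' where "p = l * p'" using l by blast
  have "of_int p' / of_int q \<in> integral_at l" using \<open>\<not> l dvd q\<close> by (intro integral_atI) auto
  then have m1: "m \<in> ideal_at l 1"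
    unfolding ideal_at_def m(1) \<open>p = l * p'\<close> by (auto intro!: image_eqI)
  then have mR: "m \<in> integral_at l" using l by (blast intro: ideal_at_integral)
  have NR: "N \<in> integral_at l" unfolding N using l mR by (intro integral_at_intros)
  have "of_int d * m * m \<in> ideal_at l (Suc 0)"
    using l m1 mR ideal_at_scale[of l "of_int d * m" m 1] by (simp add: integral_at_intros)
  note unit = ideal_at_unit[OF l(1) this]
  have ee: "of_int e * of_int e = (1 :: rat)" using e by (simp flip: of_int_mult)
  have k_inv: "1 / k = of_int e * (1 / (1 + of_int d * m * m))"
  proof -
    have "(of_int e :: rat) \<noteq> 0" using ee by auto
    then have "1 / of_int e = (of_int e :: rat)" using ee by (simp add: field_simps)
    then show ?thesis by (simp add: k power2_eq_square mult.assoc) 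
        (metis divide_divide_eq_left mult_1 times_divide_eq_left divide_inverse)
  qed
  have kR: "1 / k \<in> integral_at l" unfolding k_inv using l unit(2) by (intro integral_at_intros)
  have "k \<noteq> 0" using unit(1) ee by (auto simp: k power2_eq_square mult.assoc)
  have "m \<noteq> 0" using \<open>m > 1\<close> by simp
  have "(1 / m^2) / (k / m^3) = 1 / k * m"
    using \<open>m \<noteq> 0\<close> by (simp add: power2_eq_square power3_eq_cube)
  moreover have "1 / k * m \<in> ideal_at l 1"
    using l(1) kR m1 by (rule ideal_at_scale)
  ultimately have z: "(1 / m^2) / (k / m^3) \<in> ideal_at l 1" by simp
  have "1 / (k / m^3) = 1 / k * m * m * m" by (simp add: power3_eq_cube)
  moreover have "1 / k * m * m * m \<in> ideal_at l 1"
    using l(1) kR mR m1 by (intro ideal_at_scale integral_at_mult)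
  ultimately have w: "1 / (k / m^3) \<in> ideal_at l 1" by (simp only:)
  have curve: "(k / m^3)^2 = (1 / m^2)^3 + 2 * (2 * N^2 + 2 * N - 1) * (1 / m^2)^2
      + - (4 * N - 1) * (1 / m^2)"
    using P unfolding Affine_in_E by (simp only: mult_minus_left add_uminus_conv_diff)
  have "2 * (2 * N^2 + 2 * N - 1) \<in> integral_at l"
    using l(1) NR by (intro integral_at_intros)
  moreover have "- (4 * N - 1) \<in> integral_at l"
    using l(1) NR by (intro integral_at_intros)
  ultimately have "Affine (1 / m^2) (k / m^3) [^]\<^bsub>E N\<^esub> n \<noteq> Infinity" if "n > 0" for n :: nat
    unfolding E_eq
    using \<open>k \<noteq> 0\<close> \<open>m \<noteq> 0\<close> that
    by (intro kernel_of_reduction_pow_neq_Infinity[OF l(1) _ _ curve _ _ z w]) simp_all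
  moreover have "\<one>\<^bsub>E N\<^esub> = Infinity" by (simp add: E_eq ec_group_def)
  ultimately show ?thesis using P unfolding non_torsion_def by simp
qed

text \<open>Moves all conditions into the rationals. \<open>S \<ge> 0\<close> makes the rational
  root of \<open>B\<close> the one meant by \<open>sqrt\<close>; the ratio is stated with positive
  factors, the two sign changes cancelling.\<close>

lemma leads_toI:
  fixes N u v x S s f g h :: rat
  assumes Q: "Affine u v \<in> carrier (E N)" and nz: "(u - 1) * (u + 4 * N - 1) \<noteq> 0"
    and x: "x = - (4 * N * (v + 2 * N * u) / ((u - 1) * (u + 4 * N - 1)))" "x \<noteq> 0"
    and B: "x^4 + 4 * (2 * N - 1) * x^3 + 4 * (4 * N^2 - 2 * N + 1) * x^2
        - 32 * N^2 * x + 16 * N^2 = S^2" and "S \<ge> 0" and "s > 0"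
    and f: "f = s / (2 * x) * (- (x^2) - 2 * (2 * N - 1) * x + 4 * N - S)"
    and g: "g = s * x"
    and h: "h = s / (2 * x) * (- (x^2) + 2 * (2 * N + 1) * x - 4 * N + S)"
    and pos: "f > 0" "g > 0" "h > 0"
    and tri: "g + h - f > 0" "h + f - g > 0" "f + g - h > 0"
    and ratio: "2 * f * g * h = N * ((f + g + h) * (g + h - f) * (h + f - g))"
  shows "leads_to N (Affine u v) (of_rat f) (of_rat g) (of_rat h)"
proof -
  have sqrtB: "sqrt (of_rat (S^2)) = of_rat S"
    using \<open>S \<ge> 0\<close> by (simp add: of_rat_power)
  have "triangle_with_ratio (of_rat N) (of_rat f) (of_rat g) (of_rat h)"
  proof (rule triangle_with_ratioI)
    have "(of_rat f :: real) < of_rat (g + h)" "(of_rat g :: real) < of_rat (h + f)"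
      "(of_rat h :: real) < of_rat (f + g)"
      using tri by (simp_all only: of_rat_less)
    then show "(of_rat f :: real) < of_rat g + of_rat h" "(of_rat g :: real) < of_rat h + of_rat f"
      "(of_rat h :: real) < of_rat f + of_rat g"
      by (simp_all only: of_rat_add)
    have "2 * f * g * h = N * ((f + g + h) * (f - g - h) * (g - h - f))"
      unfolding ratio by (simp add: algebra_simps)
    then have "(of_rat (2 * f * g * h) :: real) =
        of_rat (N * ((f + g + h) * (f - g - h) * (g - h - f)))" by simp
    then show "2 * of_rat f * of_rat g * of_rat h =
        of_rat N * ((of_rat f + of_rat g + of_rat h) * (of_rat f - of_rat g - of_rat h) *
          (of_rat g - of_rat h - of_rat f) :: real)"
      by (simp only: of_rat_mult of_rat_add of_rat_diff of_rat_numeral_eq)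
  qed (use pos in simp_all)
  moreover have "(of_rat f :: real) = of_rat s / (2 * of_rat x) *
      (of_rat (- (x^2) - 2 * (2 * N - 1) * x + 4 * N) - of_rat S)"
    unfolding f by (simp only: of_rat_mult of_rat_diff of_rat_divide of_rat_numeral_eq)
  moreover have "(of_rat g :: real) = of_rat s * of_rat x"
    unfolding g by (simp only: of_rat_mult)
  moreover have "(of_rat h :: real) = of_rat s / (2 * of_rat x) *
      (of_rat (- (x^2) + 2 * (2 * N + 1) * x - 4 * N) + of_rat S)"
    unfolding h by (simp only: of_rat_mult of_rat_add of_rat_divide of_rat_numeral_eq)
  ultimately show ?thesis
    unfolding leads_to_def Let_def using nz x(2) \<open>s > 0\<close>
    by (intro conjI[OF Q] exI[of "\<lambda>u. \<exists>v. _ u v" u] exI[of "\<lambda>v. _ v \<and> _ v" v],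
      unfold x(1)[symmetric] B sqrtB) (intro conjI exI[of _ s]; simp)
qed

text \<open>
  Both families have the shape \<open>x = (m + 1) d / (m e)\<close>, \<open>\<surd>B = S / (m e)\<^sup>2\<close>, and the scaling
  factor \<open>m d e\<close> clears the denominators of the sides.
\<close>

lemma leads_to_family:
  fixes N m d e S U V f g h :: rat
  defines "X \<equiv> (m + 1) * d" and "Y \<equiv> m * e"
  defines "u \<equiv> - (U / d^2)" and "v \<equiv> V / d^3"
  assumes Q: "Affine u v \<in> carrier (E N)"
    and nz: "U + d^2 \<noteq> 0" "(4 * N - 1) * d^2 - U \<noteq> 0"
    and m: "m > 1" and d: "d > 0" and e: "e > 0" and "S > 0"
    and x: "Y * (4 * N * (V - 2 * N * U * d)) = (m + 1) * (U + d^2) * ((4 * N - 1) * d^2 - U)"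
    and B: "X^4 + 4 * (2 * N - 1) * X^3 * Y + 4 * (4 * N^2 - 2 * N + 1) * X^2 * Y^2
        - 32 * N^2 * X * Y^3 + 16 * N^2 * Y^4 = S^2"
    and f: "2 * (m + 1) * f = - (X^2) - 2 * (2 * N - 1) * X * Y + 4 * N * Y^2 - S"
    and g: "g = (m + 1) * d^2"
    and h: "2 * (m + 1) * h = - (X^2) + 2 * (2 * N + 1) * X * Y - 4 * N * Y^2 + S"
    and pos: "f > 0" "h > 0"
    and tri: "g + h - f > 0" "h + f - g > 0" "f + g - h > 0"
    and ratio: "2 * f * g * h = N * ((f + g + h) * (g + h - f) * (h + f - g))"
  shows "leads_to N (Affine u v) (of_rat f) (of_rat g) (of_rat h)"
proof (rule leads_toI[where x = "X / Y" and S = "S / Y^2" and s = "m * d * e"])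
  have "X > 0" "Y > 0" using m d e by (simp_all add: X_def Y_def)
  have u1: "u - 1 = - ((U + d^2) / d^2)" using d by (simp add: u_def field_simps)
  have u2: "u + 4 * N - 1 = ((4 * N - 1) * d^2 - U) / d^2" using d by (simp add: u_def field_simps)
  have uv: "v + 2 * N * u = (V - 2 * N * U * d) / d^3"
    using d by (simp add: u_def v_def field_simps power2_eq_square power3_eq_cube)
  show nz': "(u - 1) * (u + 4 * N - 1) \<noteq> 0" unfolding u1 u2 using nz d by simp
  have "Y * (4 * N * (v + 2 * N * u)) = Y * (4 * N * (V - 2 * N * U * d)) / d^3"
    by (simp add: uv)
  also have "\<dots> = - X * ((u - 1) * (u + 4 * N - 1))"
    unfolding x u1 u2 X_def using d by (simp add: power2_eq_square power3_eq_cube mult.assoc)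
  finally have x': "Y * (4 * N * (v + 2 * N * u)) = - X * ((u - 1) * (u + 4 * N - 1))" .
  show "X / Y = - (4 * N * (v + 2 * N * u) / ((u - 1) * (u + 4 * N - 1)))"
    using x' nz' \<open>Y > 0\<close> by (simp add: frac_eq_eq eq_divide_eq divide_eq_eq mult_ac flip: minus_divide_left)
  show "(X / Y)^4 + 4 * (2 * N - 1) * (X / Y)^3 + 4 * (4 * N^2 - 2 * N + 1) * (X / Y)^2
        - 32 * N^2 * (X / Y) + 16 * N^2 = (S / Y^2)^2" (is "?L = ?R")
  proof -
    have "?L = (X^4 + 4 * (2 * N - 1) * X^3 * Y + 4 * (4 * N^2 - 2 * N + 1) * X^2 * Y^2
        - 32 * N^2 * X * Y^3 + 16 * N^2 * Y^4) / Y^4"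
      using \<open>Y > 0\<close> by (simp add: add_divide_distrib diff_divide_distrib power_divide power4_eq_xxxx power3_eq_cube power2_eq_square)
    also have "\<dots> = ?R" unfolding B by (simp add: power_divide)
    finally show ?thesis .
  qed
  \<comment> \<open>With this scaling \<open>s / (2 x)\<close> is \<open>Y^2 / (2 (m + 1))\<close>:
    the factor \<open>Y^2\<close> clears the denominators in \<open>X / Y\<close> and
    \<open>S / Y^2\<close>, and \<open>2 (m + 1)\<close> is the factor in the hypotheses on
    \<open>f\<close> and \<open>h\<close>.\<close>
  have "m * d * e / (2 * (M * d / (m * e))) = (m * e)^2 / (2 * M)" if "M > 0" for M
    using m d e that by (simp add: field_simps power2_eq_square)
  from this[of "m + 1"] have sx: "m * d * e / (2 * (X / Y)) = Y^2 / (2 * (m + 1))"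
    using m by (simp add: X_def Y_def)
  have m1: "2 * (m + 1) \<noteq> 0" using m by simp
  have "f = (- (X^2) - 2 * (2 * N - 1) * X * Y + 4 * N * Y^2 - S) / (2 * (m + 1))"
    using f m1 by (metis nonzero_mult_div_cancel_left)
  also have "\<dots> = Y^2 / (2 * (m + 1)) *
      (- ((X / Y)^2) - 2 * (2 * N - 1) * (X / Y) + 4 * N - S / Y^2)"
    using \<open>Y > 0\<close> by (simp add: algebra_simps power_divide power2_eq_square add_divide_distrib diff_divide_distrib)
  finally show "f = m * d * e / (2 * (X / Y)) *
      (- ((X / Y)^2) - 2 * (2 * N - 1) * (X / Y) + 4 * N - S / Y^2)"
    unfolding sx .
  have "h = (- (X^2) + 2 * (2 * N + 1) * X * Y - 4 * N * Y^2 + S) / (2 * (m + 1))"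
    using h m1 by (metis nonzero_mult_div_cancel_left)
  also have "\<dots> = Y^2 / (2 * (m + 1)) *
      (- ((X / Y)^2) + 2 * (2 * N + 1) * (X / Y) - 4 * N + S / Y^2)"
    using \<open>Y > 0\<close> by (simp add: algebra_simps power_divide power2_eq_square add_divide_distrib diff_divide_distrib)
  finally show "h = m * d * e / (2 * (X / Y)) *
      (- ((X / Y)^2) + 2 * (2 * N + 1) * (X / Y) - 4 * N + S / Y^2)"
    unfolding sx .
  show "g = m * d * e * (X / Y)"
    using m e by (simp add: g X_def Y_def power2_eq_square)
  show "X / Y \<noteq> 0" "S / Y^2 \<ge> 0" "m * d * e > 0" "g > 0"
    using \<open>X > 0\<close> \<open>Y > 0\<close> \<open>S > 0\<close> m d e by (simp_all add: g)
qed (use Q pos tri ratio in auto)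

section \<open>The sum of \<open>-P\<close> and \<open>-T6\<close>, and the two families\<close>

lemma ec_group_mult: "P \<otimes>\<^bsub>ec_group a b\<^esub> Q = ec_add a b P Q"
  by (simp add: ec_group_def)

lemma inv_in_E: "Affine u v \<in> carrier (E N) \<Longrightarrow>
    inv\<^bsub>E N\<^esub> (Affine u v) = Affine u (- v) \<and> Affine u (- v) \<in> carrier (E N)"
  using ec_inv[of "Affine u v"] by (simp add: E_eq ec_group_def)

text \<open>The chord through \<open>-P\<close> and \<open>-T6\<close> has slope
  \<open>L / (m d)\<close>; the three equations are the formulas for the slope and for both
  coordinates of the sum, cleared of denominators. By \<open>N > 1 / 4\<close> the abscissa
  \<open>1 - 4 N\<close> is negative while \<open>1 / m^2\<close> is not, so the tangent case cannot
  arise.\<close>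

lemma inv_diff_T6:
  fixes N m d k L U V :: rat
  defines "P \<equiv> Affine (1 / m^2) (k / m^3)"
  assumes P: "P \<in> carrier (E N)" and m: "m \<noteq> 0" and d: "d \<noteq> 0" and N: "N > 1 / 4"
    and slope: "L * (m^2 * (1 - 4 * N) - 1) = d * (k - m^3 * (2 * N * (4 * N - 1)))"
    and U: "L^2 - (m * d)^2 * (2 * (2 * N^2 + 2 * N - 1) + 1 - 4 * N) - d^2 = - U * m^2"
    and V: "L * (d^2 + m^2 * U) + k * d^3 = V * m^3"
  shows "inv\<^bsub>E N\<^esub> P \<otimes>\<^bsub>E N\<^esub> inv\<^bsub>E N\<^esub> (T6 N) = Affine (- (U / d^2)) (V / d^3)"
    and "Affine (- (U / d^2)) (V / d^3) \<in> carrier (E N)"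
proof -
  define l where "l = L / (m * d)"
  have L: "m * d * l = L" using m d by (simp add: l_def)
  have "1 / m^2 \<ge> 0" by simp
  moreover have "1 - 4 * N < 0" using N by simp
  ultimately have ne: "1 / m^2 - (1 - 4 * N) \<noteq> 0" by linarith
  have "m^3 * d * (l * (1 - 4 * N - 1 / m^2)) = (m * d * l) * (m^2 * (1 - 4 * N) - 1)"
    using m by (simp add: field_simps power2_eq_square power3_eq_cube)
  also have "\<dots> = m^3 * d * (k / m^3 - 2 * N * (4 * N - 1))"
    unfolding L slope using m by (simp add: field_simps)
  finally have "l * (1 - 4 * N - 1 / m^2) = k / m^3 - 2 * N * (4 * N - 1)"
    using m d by simp
  then have "- (2 * N * (4 * N - 1)) - - (k / m^3) = l * (1 - 4 * N - 1 / m^2)" by simp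
  then have l: "(- (2 * N * (4 * N - 1)) - - (k / m^3)) / (1 - 4 * N - 1 / m^2) = l"
    using ne by (metis minus_diff_eq neg_equal_0_iff_equal nonzero_mult_div_cancel_right)
  have "(m * d)^2 * (l^2 - 2 * (2 * N^2 + 2 * N - 1) - 1 / m^2 - (1 - 4 * N)) =
      (m * d * l)^2 - (m * d)^2 * (2 * (2 * N^2 + 2 * N - 1) + 1 - 4 * N) - d^2"
    using m by (simp add: field_simps power2_eq_square)
  also have "\<dots> = (m * d)^2 * (- (U / d^2))"
    unfolding L U using d by (simp add: power_mult_distrib)
  finally have u: "l^2 - 2 * (2 * N^2 + 2 * N - 1) - 1 / m^2 - (1 - 4 * N) = - (U / d^2)"
    by (rule mult_left_cancel[THEN iffD1, rotated]) (use m d in simp)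
  have "m^3 * d^3 * (l * (1 / m^2 - - (U / d^2)) - - (k / m^3)) =
      (m * d * l) * (d^2 + m^2 * U) + k * d^3"
    using m d by (simp add: field_simps power2_eq_square power3_eq_cube)
  also have "\<dots> = m^3 * d^3 * (V / d^3)" unfolding L V using d by simp
  finally have v: "l * (1 / m^2 - - (U / d^2)) - - (k / m^3) = V / d^3"
    by (rule mult_left_cancel[THEN iffD1, rotated]) (use m d in simp)
  have T: "Affine (1 - 4 * N) (2 * N * (4 * N - 1)) \<in> carrier (E N)"
    using T6_in_E by (simp add: T6_def)
  note inv = inv_in_E[OF P[unfolded P_def]] inv_in_E[OF T]
  have "inv\<^bsub>E N\<^esub> P \<otimes>\<^bsub>E N\<^esub> inv\<^bsub>E N\<^esub> (T6 N) =
      ec_add (2 * (2 * N^2 + 2 * N - 1)) (- (4 * N - 1))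
        (Affine (1 / m^2) (- (k / m^3))) (Affine (1 - 4 * N) (- (2 * N * (4 * N - 1))))"
    unfolding P_def T6_def inv[THEN conjunct1] unfolding E_eq ec_group_mult ..
  also have "\<dots> = Affine (- (U / d^2)) (V / d^3)"
  proof -
    have "1 / m^2 \<noteq> 1 - 4 * N" using ne by simp
    then show ?thesis
      unfolding ec_add.simps Let_def by (simp only: if_False simp_thms l u v)
  qed
  finally show eq: "inv\<^bsub>E N\<^esub> P \<otimes>\<^bsub>E N\<^esub> inv\<^bsub>E N\<^esub> (T6 N) = Affine (- (U / d^2)) (V / d^3)" .
  show "Affine (- (U / d^2)) (V / d^3) \<in> carrier (E N)"
    unfolding eq[symmetric] P_def T6_def inv[THEN conjunct1]
    using inv[THEN conjunct2] unfolding E_eq ec_group_mult by (rule ec_add_closed)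
qed

lemma family_plus:
  fixes m :: rat
  assumes m: "m > 1"
  defines "N \<equiv> m^2 + 1" and "d \<equiv> 2 * m^2 - m + 1" and "e \<equiv> 2 * m^2 + m + 1"
  defines "P \<equiv> Affine (1 / m^2) ((3 * m^2 + 1) / m^3)"
  defines "U \<equiv> (4 * m^2 + 3) * (m + 1)^2"
    and "V \<equiv> 2 * (m + 1) * (4 * m^2 + 3) * (m^2 + 1) * (2 * m^3 + m^2 + 2 * m - 1)"
  shows "non_torsion (E N) P"
    and "inv\<^bsub>E N\<^esub> P \<otimes>\<^bsub>E N\<^esub> inv\<^bsub>E N\<^esub> (T6 N) = Affine (- (U / d^2)) (V / d^3)"
    and "leads_to N (Affine (- (U / d^2)) (V / d^3))
      (of_rat ((m - 1) * e^2)) (of_rat ((m + 1) * d^2)) (of_rat (4 * m * (m^2 + 1)))"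
proof -
  have "m > 0" "m \<noteq> 0" using m by simp_all
  have "m * m > m * 1" using m by (intro mult_strict_left_mono) auto
  then have m2: "m^2 > m" by (simp add: power2_eq_square)
  then have "m^2 > 1" using m by simp
  have "d > 0" "e > 0" using m m2 by (simp_all add: d_def e_def)
  have P: "P \<in> carrier (E N)"
    unfolding P_def Affine_in_E N_def using \<open>m \<noteq> 0\<close>
    by (simp add: field_simps power2_eq_square power3_eq_cube)
  then show "non_torsion (E N) P"
    unfolding P_def
    by (intro reciprocal_square_point_non_torsion[OF m, of N 1 _ 1 3]) (simp_all add: N_def)
  have N: "N > 1 / 4" using \<open>m^2 > 1\<close> by (simp add: N_def)
  \<comment> \<open>Here \<open>m^2 (1 - 4 N) - 1 = - d e\<close> and
    \<open>3 m^2 + 1 - 2 N (4 N - 1) m^3 = - L e\<close>; cancelling \<open>e\<close> leaves the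
    slope \<open>L / (m d)\<close>.\<close>
  define L where "L = 4 * m^5 - 2 * m^4 + 6 * m^3 - 2 * m^2 + m - 1"
  have "L * (m^2 * (1 - 4 * N) - 1) = d * (3 * m^2 + 1 - m^3 * (2 * N * (4 * N - 1)))"
    unfolding L_def N_def d_def by algebra
  moreover have "L^2 - (m * d)^2 * (2 * (2 * N^2 + 2 * N - 1) + 1 - 4 * N) - d^2 = - U * m^2"
    unfolding L_def N_def d_def U_def by algebra
  moreover have "L * (d^2 + m^2 * U) + (3 * m^2 + 1) * d^3 = V * m^3"
    unfolding L_def N_def d_def U_def V_def by algebra
  moreover have "d \<noteq> 0" using \<open>d > 0\<close> by simp
  ultimately have Q: "inv\<^bsub>E N\<^esub> P \<otimes>\<^bsub>E N\<^esub> inv\<^bsub>E N\<^esub> (T6 N) = Affine (- (U / d^2)) (V / d^3)"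
      "Affine (- (U / d^2)) (V / d^3) \<in> carrier (E N)"
    using inv_diff_T6[OF P[unfolded P_def] \<open>m \<noteq> 0\<close> _ N] unfolding P_def by blast+
  then show "inv\<^bsub>E N\<^esub> P \<otimes>\<^bsub>E N\<^esub> inv\<^bsub>E N\<^esub> (T6 N) = Affine (- (U / d^2)) (V / d^3)" by blast
  have u1: "U + d^2 = 4 * (m^2 + 1) * e" unfolding U_def d_def e_def by algebra
  have u2: "(4 * N - 1) * d^2 - U = 4 * m * (m - 1) * (m^2 + 1) * (4 * m^2 + 3)"
    unfolding N_def U_def d_def by algebra
  have uv: "V - 2 * N * U * d = 4 * (m + 1) * (4 * m^2 + 3) * (m^2 + 1) * (m - 1)"
    unfolding N_def U_def V_def d_def by algebra
  have "m^2 + 1 > 0" "4 * m^2 + 3 > 0" using \<open>m^2 > 1\<close> by simp_all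
  \<comment> \<open>\<open>S\<close> is \<open>(m e)^2\<close> times the root of \<open>B\<close>,
    which is a square along the family.\<close>
  define S where "S = 4 * m^6 - 8 * m^5 + 11 * m^4 - 2 * m^3 + 8 * m^2 + 2 * m + 1"
  define f g h where "f = (m - 1) * e^2" and "g = (m + 1) * d^2" and "h = 4 * m * (m^2 + 1)"
  \<comment> \<open>These factorizations reduce the triangle inequalities to signs of factors and
    the ratio to a comparison of products.\<close>
  have 1: "h + f - g = 2 * (m - 1) * d" unfolding f_def g_def h_def d_def e_def by algebra
  have 2: "g + h - f = 2 * (m + 1) * e" unfolding f_def g_def h_def d_def e_def by algebra
  have 3: "f + g + h = 2 * m * d * e" unfolding f_def g_def h_def d_def e_def by algebra
  have 4: "f + g - h = 2 * m * ((4 * m^2 + 3) * (m^2 - 1))"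
    unfolding f_def g_def h_def d_def e_def by algebra
  \<comment> \<open>Regrouped so that no summand is negative for \<open>m > 1\<close>.\<close>
  have "S = m^4 * (4 * (m - 1)^2 + 5) + 2 * m^3 * (m - 1) + 8 * m^2 + 2 * m + 1"
    unfolding S_def by algebra
  moreover have "m^4 * (4 * (m - 1)^2 + 5) \<ge> 0" "2 * m^3 * (m - 1) \<ge> 0" using m by simp_all
  ultimately have "S > 0" using \<open>m^2 > 1\<close> m by linarith
  show "leads_to N (Affine (- (U / d^2)) (V / d^3)) (of_rat ((m - 1) * e^2))
      (of_rat ((m + 1) * d^2)) (of_rat (4 * m * (m^2 + 1)))"
  proof (fold f_def g_def h_def, rule leads_to_family[OF Q(2) _ _ m \<open>d > 0\<close> \<open>e > 0\<close> \<open>S > 0\<close>])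
    show "U + d^2 \<noteq> 0" "(4 * N - 1) * d^2 - U \<noteq> 0"
      unfolding u1 u2 using m \<open>e > 0\<close> \<open>m^2 + 1 > 0\<close> \<open>4 * m^2 + 3 > 0\<close> by simp_all
    show "m * e * (4 * N * (V - 2 * N * U * d)) = (m + 1) * (U + d^2) * ((4 * N - 1) * d^2 - U)"
      unfolding u1 u2 uv unfolding N_def by algebra
    show "((m + 1) * d)^4 + 4 * (2 * N - 1) * ((m + 1) * d)^3 * (m * e)
        + 4 * (4 * N^2 - 2 * N + 1) * ((m + 1) * d)^2 * (m * e)^2
        - 32 * N^2 * ((m + 1) * d) * (m * e)^3 + 16 * N^2 * (m * e)^4 = S^2"
      unfolding N_def d_def e_def S_def by algebra
    show "2 * (m + 1) * f = - (((m + 1) * d)^2) - 2 * (2 * N - 1) * ((m + 1) * d) * (m * e)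
        + 4 * N * (m * e)^2 - S"
      unfolding N_def d_def e_def S_def f_def by algebra
    show "2 * (m + 1) * h = - (((m + 1) * d)^2) + 2 * (2 * N + 1) * ((m + 1) * d) * (m * e)
        - 4 * N * (m * e)^2 + S"
      unfolding N_def d_def e_def S_def h_def by algebra
    show "g = (m + 1) * d^2" by (rule g_def)
    show "f > 0" "h > 0" using m \<open>e > 0\<close> \<open>m^2 + 1 > 0\<close> by (simp_all add: f_def h_def)
    show "g + h - f > 0" "h + f - g > 0" "f + g - h > 0"
      unfolding 1 2 4 using m \<open>d > 0\<close> \<open>e > 0\<close> \<open>m^2 > 1\<close> by (simp_all add: add_pos_pos)
    show "2 * f * g * h = N * ((f + g + h) * (g + h - f) * (h + f - g))"
      unfolding 1 2 3 unfolding f_def g_def h_def N_def by algebra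
  qed
qed

lemma family_minus:
  fixes m :: rat
  assumes m: "m > 1" and N4: "m^2 - 1 > 1 / 4"
  defines "N \<equiv> m^2 - 1" and "d \<equiv> 2 * m - 1" and "e \<equiv> 2 * m + 1"
  defines "P \<equiv> Affine (1 / m^2) ((m^2 - 1) / m^3)"
  defines "U \<equiv> 4 * m^2 - 5"
    and "V \<equiv> 2 * (m - 1) * (4 * m^2 - 5) * (2 * m^2 + m + 1)"
  shows "non_torsion (E N) P"
    and "inv\<^bsub>E N\<^esub> P \<otimes>\<^bsub>E N\<^esub> inv\<^bsub>E N\<^esub> (T6 N) = Affine (- (U / d^2)) (V / d^3)"
    and "leads_to N (Affine (- (U / d^2)) (V / d^3))
      (of_rat ((m - 1) * e^2)) (of_rat ((m + 1) * d^2)) (of_rat (4 * m))"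
proof -
  have "m > 0" "m \<noteq> 0" using m by simp_all
  \<comment> \<open>Here \<open>N > 1 / 4\<close> means \<open>4 m^2 > 5\<close>; it is the triangle
    inequality \<open>f + g > h\<close>, since \<open>f + g - h = 2 m U\<close>.\<close>
  have "U > 0" using N4 by (simp add: U_def)
  have "d > 0" "e > 0" using m by (simp_all add: d_def e_def)
  have P: "P \<in> carrier (E N)"
    unfolding P_def Affine_in_E N_def using \<open>m \<noteq> 0\<close>
    by (simp add: field_simps power2_eq_square power3_eq_cube)
  then show "non_torsion (E N) P"
    unfolding P_def
    by (intro reciprocal_square_point_non_torsion[OF m, of N "- 1" _ "- 1" "- 1"])
      (simp_all add: N_def)
  have N: "N > 1 / 4" using N4 by (simp add: N_def)
  \<comment> \<open>Now \<open>m^2 (1 - 4 N) - 1 = - (m^2 - 1) d e\<close> and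
    \<open>m^2 - 1 - 2 N (4 N - 1) m^3 = - (m^2 - 1) L e\<close>, with \<open>(m^2 - 1) e\<close>
    cancelling in the slope.\<close>
  define L where "L = 4 * m^4 - 2 * m^3 - 4 * m^2 + 2 * m - 1"
  have "L * (m^2 * (1 - 4 * N) - 1) = d * (m^2 - 1 - m^3 * (2 * N * (4 * N - 1)))"
    unfolding L_def N_def d_def by algebra
  moreover have "L^2 - (m * d)^2 * (2 * (2 * N^2 + 2 * N - 1) + 1 - 4 * N) - d^2 = - U * m^2"
    unfolding L_def N_def d_def U_def by algebra
  moreover have "L * (d^2 + m^2 * U) + (m^2 - 1) * d^3 = V * m^3"
    unfolding L_def d_def U_def V_def by algebra
  moreover have "d \<noteq> 0" using \<open>d > 0\<close> by simp
  ultimately have Q: "inv\<^bsub>E N\<^esub> P \<otimes>\<^bsub>E N\<^esub> inv\<^bsub>E N\<^esub> (T6 N) = Affine (- (U / d^2)) (V / d^3)"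
      "Affine (- (U / d^2)) (V / d^3) \<in> carrier (E N)"
    using inv_diff_T6[OF P[unfolded P_def] \<open>m \<noteq> 0\<close> _ N] unfolding P_def by blast+
  then show "inv\<^bsub>E N\<^esub> P \<otimes>\<^bsub>E N\<^esub> inv\<^bsub>E N\<^esub> (T6 N) = Affine (- (U / d^2)) (V / d^3)" by blast
  have u1: "U + d^2 = 4 * (m - 1) * e" unfolding U_def d_def e_def by algebra
  have u2: "(4 * N - 1) * d^2 - U = 4 * m * (m - 1) * U"
    unfolding N_def U_def d_def by algebra
  have uv: "V - 2 * N * U * d = 4 * U * (m - 1)"
    unfolding N_def U_def V_def d_def by algebra
  define S where "S = 4 * m^4 - m^2 + 4 * m + 1"
  define f g h where "f = (m - 1) * e^2" and "g = (m + 1) * d^2" and "h = 4 * m"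
  have 1: "h + f - g = 2 * d" unfolding f_def g_def h_def d_def e_def by algebra
  have 2: "g + h - f = 2 * e" unfolding f_def g_def h_def d_def e_def by algebra
  have 3: "f + g + h = 2 * m * d * e" unfolding f_def g_def h_def d_def e_def by algebra
  have 4: "f + g - h = 2 * m * U" unfolding f_def g_def h_def d_def e_def U_def by algebra
  have "S = m^2 * U + 4 * m^2 + 4 * m + 1" unfolding S_def U_def by algebra
  then have "S > 0" using \<open>U > 0\<close> m by (simp add: add_pos_pos)
  show "leads_to N (Affine (- (U / d^2)) (V / d^3)) (of_rat ((m - 1) * e^2))
      (of_rat ((m + 1) * d^2)) (of_rat (4 * m))"
  proof (fold f_def g_def h_def, rule leads_to_family[OF Q(2) _ _ m \<open>d > 0\<close> \<open>e > 0\<close> \<open>S > 0\<close>])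
    show "U + d^2 \<noteq> 0" "(4 * N - 1) * d^2 - U \<noteq> 0"
      unfolding u1 u2 using m \<open>e > 0\<close> \<open>U > 0\<close> by simp_all
    show "m * e * (4 * N * (V - 2 * N * U * d)) = (m + 1) * (U + d^2) * ((4 * N - 1) * d^2 - U)"
      unfolding u1 u2 uv unfolding N_def by algebra
    show "((m + 1) * d)^4 + 4 * (2 * N - 1) * ((m + 1) * d)^3 * (m * e)
        + 4 * (4 * N^2 - 2 * N + 1) * ((m + 1) * d)^2 * (m * e)^2
        - 32 * N^2 * ((m + 1) * d) * (m * e)^3 + 16 * N^2 * (m * e)^4 = S^2"
      unfolding N_def d_def e_def S_def by algebra
    show "2 * (m + 1) * f = - (((m + 1) * d)^2) - 2 * (2 * N - 1) * ((m + 1) * d) * (m * e)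
        + 4 * N * (m * e)^2 - S"
      unfolding N_def d_def e_def S_def f_def by algebra
    show "2 * (m + 1) * h = - (((m + 1) * d)^2) + 2 * (2 * N + 1) * ((m + 1) * d) * (m * e)
        - 4 * N * (m * e)^2 + S"
      unfolding N_def d_def e_def S_def h_def by algebra
    show "g = (m + 1) * d^2" by (rule g_def)
    show "f > 0" "h > 0" using m \<open>e > 0\<close> by (simp_all add: f_def h_def)
    show "g + h - f > 0" "h + f - g > 0" "f + g - h > 0"
      unfolding 1 2 4 using m \<open>d > 0\<close> \<open>e > 0\<close> \<open>U > 0\<close> by simp_all
    show "2 * f * g * h = N * ((f + g + h) * (g + h - f) * (h + f - g))"
      unfolding 1 2 3 unfolding f_def g_def h_def N_def by algebra
  qed
qed

theorem theorem6:
  fixes N m :: rat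
  assumes "N > 1/4" and "m > 1"
  shows
    "T6 N \<in> carrier (E N) \<and>
     (N = m^2 + 1 \<longrightarrow>
       (let P = Affine (1 / m^2) ((3 * m^2 + 1) / m^3);
            Q = inv\<^bsub>E N\<^esub> P \<otimes>\<^bsub>E N\<^esub> inv\<^bsub>E N\<^esub> (T6 N)
        in abelian_rank (E N) > 0 \<and>
           non_torsion (E N) P \<and>
           Q = Affine
             (- ((4 * m^2 + 3) * (m + 1)^2 / (2 * m^2 - m + 1)^2))
             (2 * (m + 1) * (4 * m^2 + 3) * (m^2 + 1) * (2 * m^3 + m^2 + 2 * m - 1)
                / (2 * m^2 - m + 1)^3) \<and>
           leads_to N Q
             (of_rat ((m - 1) * (2 * m^2 + m + 1)^2))
             (of_rat ((m + 1) * (2 * m^2 - m + 1)^2))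
             (of_rat (4 * m * (m^2 + 1))))) \<and>
     (N = m^2 - 1 \<longrightarrow>
       (let P = Affine (1 / m^2) ((m^2 - 1) / m^3);
            Q = inv\<^bsub>E N\<^esub> P \<otimes>\<^bsub>E N\<^esub> inv\<^bsub>E N\<^esub> (T6 N)
        in abelian_rank (E N) > 0 \<and>
           non_torsion (E N) P \<and>
           Q = Affine
             (- ((4 * m^2 - 5) / (2 * m - 1)^2))
             (2 * (m - 1) * (4 * m^2 - 5) * (2 * m^2 + m + 1) / (2 * m - 1)^3) \<and>
           leads_to N Q
             (of_rat ((m - 1) * (2 * m + 1)^2))
             (of_rat ((m + 1) * (2 * m - 1)^2))
             (of_rat (4 * m))))"
proof (intro conjI impI)
  show "T6 N \<in> carrier (E N)" by (rule T6_in_E)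
next
  assume N: "N = m^2 + 1"
  from abelian_rank_pos[OF family_plus(1)[OF \<open>m > 1\<close>, unfolded E_eq]] family_plus[OF \<open>m > 1\<close>]
  show "let P = Affine (1 / m^2) ((3 * m^2 + 1) / m^3);
      Q = inv\<^bsub>E N\<^esub> P \<otimes>\<^bsub>E N\<^esub> inv\<^bsub>E N\<^esub> (T6 N)
    in abelian_rank (E N) > 0 \<and> non_torsion (E N) P \<and>
      Q = Affine (- ((4 * m^2 + 3) * (m + 1)^2 / (2 * m^2 - m + 1)^2))
        (2 * (m + 1) * (4 * m^2 + 3) * (m^2 + 1) * (2 * m^3 + m^2 + 2 * m - 1)
          / (2 * m^2 - m + 1)^3) \<and>
      leads_to N Q (of_rat ((m - 1) * (2 * m^2 + m + 1)^2))
        (of_rat ((m + 1) * (2 * m^2 - m + 1)^2)) (of_rat (4 * m * (m^2 + 1)))"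
    unfolding Let_def N E_eq[symmetric] by (simp only: simp_thms)
next
  assume N: "N = m^2 - 1"
  with \<open>N > 1/4\<close> have "m^2 - 1 > 1 / 4" by simp
  from abelian_rank_pos[OF family_minus(1)[OF \<open>m > 1\<close> this, unfolded E_eq]]
    family_minus[OF \<open>m > 1\<close> this]
  show "let P = Affine (1 / m^2) ((m^2 - 1) / m^3);
      Q = inv\<^bsub>E N\<^esub> P \<otimes>\<^bsub>E N\<^esub> inv\<^bsub>E N\<^esub> (T6 N)
    in abelian_rank (E N) > 0 \<and> non_torsion (E N) P \<and>
      Q = Affine (- ((4 * m^2 - 5) / (2 * m - 1)^2))
        (2 * (m - 1) * (4 * m^2 - 5) * (2 * m^2 + m + 1) / (2 * m - 1)^3) \<and>
      leads_to N Q (of_rat ((m - 1) * (2 * m + 1)^2))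
        (of_rat ((m + 1) * (2 * m - 1)^2)) (of_rat (4 * m))"
    unfolding Let_def N E_eq[symmetric] by (simp only: simp_thms)
qed

end
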